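(* Let $\mu\in\mathcal{M}_{\mathbb{R}_+}^\times$ and $t>1$. The function $\omega_t$ is the $\eta$-transform of some $\boxtimes$-infinitely divisible measure in $\mathcal{M}_{\mathbb{R}_+}^\times$.
   Context: $\mathbb{R}_+=[0,\infty)$, $\Omega=\mathbb{C}\setminus[0,\infty)$, $\mathbb{C}^{\pm}$ are the open upper and lower half-planes. $\mathcal{M}_{\mathbb{R}_+}^\times$ is the set of Borel probability measures on $\mathbb{R}_+$ other than $\delta_0$. For such $\mu$ and $z\in\Omega$: $\psi_\mu(z)=\int\frac{zs}{1-zs}\,d\mu(s)$ and $\eta_\mu=\psi_\mu/(1+\psi_\mu)$ (the $\eta$-transform); $\eta_\mu$ never vanishes on $\Omega$ and is injective on $(-\infty,0)$. With $\eta_\mu^{-1}$ the inverse of $\eta_\mu|_{(-\infty,0)}$, put $\Sigma_\mu(z)=\eta_\mu^{-1}(z)/z$ for $z<0$ close to $0$. The multiplicative free convolution $\mu\boxtimes\nu$ of $\mu,\nu\in\mathcal{M}_{\mathbb{R}_+}^\times$ is characterized by $\Sigma_{\mu\boxtimes\nu}=\Sigma_\mu\Sigma_\nu$ for $z<0$ close to $0$. A measure $\nu$ is $\boxtimes$-infinitely divisible if for every positive integer $n$ there is a measure $\nu_n$ with $\nu=\nu_n\boxtimes\cdots\boxtimes\nu_n$ ($n$ factors). Let $\kappa_\mu(z)=z/\eta_\mu(z)$ on $\Omega$. Then $\kappa_\mu=\exp u$ for a unique analytic $u$ on $\Omega$ with $u(\overline z)=\overline{u(z)}$ and $u(\mathbb{C}^+)\subset\mathbb{C}^-\cup\mathbb{R}$.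 For $t>1$ let $\Phi_t(z)=z\exp[(t-1)u(z)]$, $z\in\Omega$. There is a unique $\mu^{\boxtimes t}\in\mathcal{M}_{\mathbb{R}_+}^\times$ with $\Sigma_{\mu^{\boxtimes t}}=\Sigma_\mu^t$ for $z<0$ close to $0$, and $\omega_t:\Omega\to\Omega$ is the analytic function satisfying $\omega_t((-\infty,0))\subset(-\infty,0)$, $\omega_t(0-)=0$, $\arg\omega_t(z)\in[\arg z,\pi)$ for $z\in\mathbb{C}^+$, $\eta_{\mu^{\boxtimes t}}=\eta_\mu\circ\omega_t$, and $\Phi_t(\omega_t(z))=z$ for $z\in\Omega$. *)

theory Defs
  imports "HOL-Complex_Analysis.Complex_Analysis" "HOL-Probability.Probability"
begin

definition slit_plane :: "complex set" where
  "slit_plane = - \<real>\<^sub>\<ge>\<^sub>0"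

(* Borel probability measures on [0,\<infinity>) other than the point mass at 0, represented as Borel
   measures on the whole real line that are concentrated on [0,\<infinity>). *)
definition pos_measures :: "real measure set" where
  "pos_measures =
     {\<mu>. sets \<mu> = sets borel \<and> prob_space \<mu> \<and> (AE s in \<mu>. 0 \<le> s) \<and> \<mu> \<noteq> return borel 0}"

definition psi :: "real measure \<Rightarrow> complex \<Rightarrow> complex" where
  "psi \<mu> z = (LINT s|\<mu>. z * complex_of_real s / (1 - z * complex_of_real s))"

definition eta :: "real measure \<Rightarrow> complex \<Rightarrow> complex" where
  "eta \<mu> z = psi \<mu> z / (1 + psi \<mu> z)"

(* The inverse is that of eta restricted to the negative half-line. It is meaningful only for
   arguments in the range of that restriction, which contains all x < 0 close to 0; Sigma is
   only ever used for such arguments. *)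
definition Sigma_transform :: "real measure \<Rightarrow> real \<Rightarrow> real" where
  "Sigma_transform \<mu> x =
     inv_into {..<0} (\<lambda>w. eta \<mu> (complex_of_real w)) (complex_of_real x) / x"

(* The convolution is rendered as the relation "\<rho> is the multiplicative free convolution of
   \<mu> and \<nu>", given by the characterization through Sigma. Such a \<rho> exists and is unique. *)
definition is_free_mult_conv :: "real measure \<Rightarrow> real measure \<Rightarrow> real measure \<Rightarrow> bool" where
  "is_free_mult_conv \<mu> \<nu> \<rho> \<longleftrightarrow>
     \<mu> \<in> pos_measures \<and> \<nu> \<in> pos_measures \<and> \<rho> \<in> pos_measures \<and>
     (\<forall>\<^sub>F x in at_left 0. Sigma_transform \<rho> x = Sigma_transform \<mu> x * Sigma_transform \<nu> x)"

(* n-fold free convolution of \<mu> with itself, n \<ge> 1 *)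
inductive is_free_mult_power :: "real measure \<Rightarrow> nat \<Rightarrow> real measure \<Rightarrow> bool"
  for \<mu> :: "real measure" where
  one: "is_free_mult_power \<mu> (Suc 0) \<mu>"
| step: "is_free_mult_power \<mu> n \<sigma> \<Longrightarrow> is_free_mult_conv \<sigma> \<mu> \<rho> \<Longrightarrow>
           is_free_mult_power \<mu> (Suc n) \<rho>"

definition free_mult_infinitely_divisible :: "real measure \<Rightarrow> bool" where
  "free_mult_infinitely_divisible \<nu> \<longleftrightarrow>
     (\<forall>n::nat. n \<ge> 1 \<longrightarrow> (\<exists>\<nu>\<^sub>n \<in> pos_measures. is_free_mult_power \<nu>\<^sub>n n \<nu>))"

(* "\<rho> is the free convolution power of \<mu> with real exponent t" *)
definition is_free_mult_real_power :: "real measure \<Rightarrow> real \<Rightarrow> real measure \<Rightarrow> bool" where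
  "is_free_mult_real_power \<mu> t \<rho> \<longleftrightarrow>
     \<rho> \<in> pos_measures \<and>
     (\<forall>\<^sub>F x in at_left 0. Sigma_transform \<rho> x = Sigma_transform \<mu> x powr t)"

definition kappa :: "real measure \<Rightarrow> complex \<Rightarrow> complex" where
  "kappa \<mu> z = z / eta \<mu> z"

(* The analytic logarithm u of kappa. These conditions determine u on the slit plane; its values
   elsewhere are irrelevant. The same applies to is_subordination below. *)
definition is_log_kappa :: "real measure \<Rightarrow> (complex \<Rightarrow> complex) \<Rightarrow> bool" where
  "is_log_kappa \<mu> u \<longleftrightarrow>
     u holomorphic_on slit_plane \<and>
     (\<forall>z\<in>slit_plane. kappa \<mu> z = exp (u z)) \<and>
     (\<forall>z\<in>slit_plane. u (cnj z) = cnj (u z)) \<and>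
     (\<forall>z. Im z > 0 \<longrightarrow> Im (u z) \<le> 0)"

definition Phi :: "(complex \<Rightarrow> complex) \<Rightarrow> real \<Rightarrow> complex \<Rightarrow> complex" where
  "Phi u t z = z * exp (complex_of_real (t - 1) * u z)"

(* "\<omega> is the subordination function of \<mu>t with respect to \<mu>", where \<mu>t is the t-th free
   convolution power of \<mu> and u is the analytic logarithm of kappa \<mu>. *)
definition is_subordination ::
  "real measure \<Rightarrow> (complex \<Rightarrow> complex) \<Rightarrow> real \<Rightarrow> real measure \<Rightarrow> (complex \<Rightarrow> complex) \<Rightarrow> bool" where
  "is_subordination \<mu> u t \<mu>t \<omega> \<longleftrightarrow>
     \<omega> holomorphic_on slit_plane \<and>
     \<omega> ` slit_plane \<subseteq> slit_plane \<and>
     (\<forall>x::real. x < 0 \<longrightarrow> (\<exists>y::real. y < 0 \<and> \<omega> (complex_of_real x) = complex_of_real y)) \<and>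
     ((\<lambda>x::real. \<omega> (complex_of_real x)) \<longlongrightarrow> 0) (at_left 0) \<and>
     (\<forall>z. Im z > 0 \<longrightarrow> Arg z \<le> Arg (\<omega> z) \<and> Arg (\<omega> z) < pi) \<and>
     (\<forall>z\<in>slit_plane. eta \<mu>t z = eta \<mu> (\<omega> z)) \<and>
     (\<forall>z\<in>slit_plane. Phi u t (\<omega> z) = z)"

end

theory Submission
  imports Defs
begin

text \<open>In the coordinate \<open>\<xi> = Ln (- z)\<close> the slit plane becomes the strip \<open>\<bar>Im \<xi>\<bar> < \<pi>\<close>, and \<open>\<eta>\<close>, the
  \<open>\<eta>\<close>-transform of \<open>\<mu>\<close>, becomes a holomorphic self-map \<open>E\<close> of the strip that is real on the real axis.
  For every \<open>c > 0\<close> the equation \<open>\<omega> exp (c u(\<omega>)) = z\<close> reads \<open>W = (\<xi> + c E(W)) / (1 + c)\<close>; its right-hand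
  side is a convex combination in the strip and, by the Schwarz lemma, a contraction on the real
  axis, so it has a holomorphic solution. A Herglotz-type representation, obtained by weak
  compactness from the Poisson formula, shows that each such solution is the \<open>\<eta>\<close>-transform of a
  measure, and so is the given \<open>\<omega>\<close>, the case \<open>c = t - 1\<close>. These measures have \<open>\<Sigma>\<close>-transform
  \<open>exp (c u)\<close>. Hence they form a convolution semigroup in \<open>c\<close>, and \<open>\<nu>\<close> is the \<open>n\<close>-th power of the
  measure with parameter \<open>(t - 1) / n\<close>.\<close>

section \<open>Self-maps of the strip\<close>

definition strip :: "complex set" where
  "strip = {\<xi>. \<bar>Im \<xi>\<bar> < pi}"

text \<open>This is the Riemann map fixing 0: \<open>exp (\<xi> / 2)\<close> opens the strip to the
  right half-plane, which the Cayley transform carries to the unit disc.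
  \<open>disc_to_strip\<close> is the inverse map.\<close>

definition strip_to_disc :: "complex \<Rightarrow> complex" where
  "strip_to_disc \<xi> = (exp (\<xi> / 2) - 1) / (exp (\<xi> / 2) + 1)"

definition disc_to_strip :: "complex \<Rightarrow> complex" where
  "disc_to_strip w = 2 * Ln ((1 + w) / (1 - w))"

lemma strip_eq_Times: "strip = {\<xi>. Im \<xi> < pi} \<inter> {\<xi>. Im \<xi> > -pi}"
  by (auto simp: strip_def)

lemma open_strip: "open strip"
  unfolding strip_eq_Times by (intro open_Int open_halfspace_Im_lt open_halfspace_Im_gt)

lemma convex_strip: "convex strip"
  unfolding strip_eq_Times by (intro convex_Int convex_halfspace_Im_lt convex_halfspace_Im_gt)

lemma of_real_in_strip [simp]: "complex_of_real x \<in> strip"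
  by (simp add: strip_def)

lemma strip_convex_combination:
  assumes "a \<in> strip" "b \<in> strip" "0 \<le> l" "l \<le> 1"
  shows "of_real (1 - l) * a + of_real l * b \<in> strip"
  using convexD_alt[OF convex_strip assms] by (simp add: scaleR_conv_of_real)

lemma Re_pos_imp_nonzero: "Re z > 0 \<Longrightarrow> z \<noteq> 0"
  by auto

lemma Re_exp_half_pos:
  assumes "\<xi> \<in> strip" shows "Re (exp (\<xi> / 2)) > 0"
  using assms by (auto simp: strip_def Re_exp intro!: mult_pos_pos cos_gt_zero_pi)

lemma norm_cayley_less_1:
  assumes "Re q > 0" shows "norm ((q - 1) / (q + 1)) < 1"
proof -
  have "(norm (q - 1))\<^sup>2 < (norm (q + 1))\<^sup>2"
    using assms by (simp only: cmod_power2) (simp add: power2_eq_square algebra_simps)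
  then have "norm (q - 1) < norm (q + 1)"
    by (rule power_less_imp_less_base) simp
  then show ?thesis by (simp add: norm_divide divide_less_eq)
qed

lemma Re_inverse_cayley_pos:
  assumes "norm w < 1" shows "Re ((1 + w) / (1 - w)) > 0"
proof -
  have "(norm w)\<^sup>2 < 1" using assms by (simp add: abs_square_less_1)
  then have "1 - (Re w)\<^sup>2 - (Im w)\<^sup>2 > 0" by (simp add: cmod_power2)
  moreover have "w \<noteq> 1" using assms by auto
  moreover have "Re ((1 + w) / (1 - w)) = (1 - (Re w)\<^sup>2 - (Im w)\<^sup>2) / (norm (1 - w))\<^sup>2"
    unfolding Re_divide cmod_power2 by (simp add: power2_eq_square algebra_simps)
  ultimately show ?thesis by simp
qed

lemma strip_to_disc_holomorphic: "strip_to_disc holomorphic_on strip"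
  unfolding strip_to_disc_def
proof (intro holomorphic_intros)
  fix \<xi> assume "\<xi> \<in> strip"
  then have "Re (exp (\<xi> / 2) + 1) > 0" using Re_exp_half_pos[of \<xi>] by simp
  then show "exp (\<xi> / 2) + 1 \<noteq> 0" by (rule Re_pos_imp_nonzero)
qed auto

lemma norm_strip_to_disc: "\<xi> \<in> strip \<Longrightarrow> norm (strip_to_disc \<xi>) < 1"
  unfolding strip_to_disc_def by (intro norm_cayley_less_1 Re_exp_half_pos)

lemma disc_to_strip_holomorphic: "disc_to_strip holomorphic_on ball 0 1"
  unfolding disc_to_strip_def
proof (intro holomorphic_intros)
  fix w :: complex assume w: "w \<in> ball 0 1"
  then show "1 - w \<noteq> 0" by auto
  from w have "Re ((1 + w) / (1 - w)) > 0" by (intro Re_inverse_cayley_pos) simp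
  then show "(1 + w) / (1 - w) \<notin> \<real>\<^sub>\<le>\<^sub>0"
    using complex_nonpos_Reals_iff by force
qed

lemma disc_to_strip_in_strip:
  assumes "norm w < 1" shows "disc_to_strip w \<in> strip"
proof -
  let ?q = "(1 + w) / (1 - w)"
  have "Re ?q > 0" by (rule Re_inverse_cayley_pos[OF assms])
  then have "\<bar>Im (Ln ?q)\<bar> < pi / 2" 
    by (intro Re_Ln_pos_lt_imp) auto
  then show ?thesis by (simp add: strip_def disc_to_strip_def)
qed

lemma disc_to_strip_strip_to_disc:
  assumes "\<xi> \<in> strip" shows "disc_to_strip (strip_to_disc \<xi>) = \<xi>"
proof -
  define q where "q = exp (\<xi> / 2)"
  have "Re (q + 1) > 0" using Re_exp_half_pos[OF assms] by (simp add: q_def)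
  then have "q + 1 \<noteq> 0" by (rule Re_pos_imp_nonzero)
  then have "1 + (q - 1) / (q + 1) = 2 * q / (q + 1)" "1 - (q - 1) / (q + 1) = 2 / (q + 1)"
    by (simp_all add: field_simps)
  with \<open>q + 1 \<noteq> 0\<close> have "(1 + (q - 1) / (q + 1)) / (1 - (q - 1) / (q + 1)) = q" by simp
  then have "disc_to_strip (strip_to_disc \<xi>) = 2 * Ln q"
    by (simp add: disc_to_strip_def strip_to_disc_def q_def)
  also have "Ln q = \<xi> / 2"
    unfolding q_def using assms by (intro Ln_exp) (auto simp: strip_def)
  finally show ?thesis by simp
qed

lemma strip_to_disc_0 [simp]: "strip_to_disc 0 = 0"
  by (simp add: strip_to_disc_def)

lemma disc_to_strip_0 [simp]: "disc_to_strip 0 = 0"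
  by (simp add: disc_to_strip_def)

text \<open>On the real axis the Riemann map is odd and increasing, so an inequality between moduli
  in the disc becomes one between absolute values on the line.\<close>

lemma strip_to_disc_of_real: "strip_to_disc (of_real x) = of_real (tanh (x / 4))"
proof -
  define c where "c = exp (x / 4)"
  have "c > 0" by (simp add: c_def)
  have "exp (x / 2) = c * c" by (simp add: c_def flip: exp_add)
  moreover have "tanh (x / 4) = (c - 1 / c) / (c + 1 / c)"
    by (simp add: tanh_altdef exp_minus c_def inverse_eq_divide)
  moreover have "\<dots> = (c * c - 1) / (c * c + 1)"
    using \<open>c > 0\<close> by (simp add: divide_simps)
  ultimately have "tanh (x / 4) = (exp (x / 2) - 1) / (exp (x / 2) + 1)"
    by simp
  then show ?thesis
    by (simp add: strip_to_disc_def flip: exp_of_real)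
qed

text \<open>The Schwarz lemma, transported to the strip after translating \<open>x\<close> and \<open>E x\<close> to the origin.\<close>

lemma strip_selfmap_nonexpansive:
  assumes hol: "E holomorphic_on strip" and maps: "E ` strip \<subseteq> strip"
    and real: "\<And>x. E (of_real x) = of_real (e x)"
  shows "\<bar>e x - e y\<bar> \<le> \<bar>x - y\<bar>"
proof -
  have shift: "\<xi> + of_real r \<in> strip \<longleftrightarrow> \<xi> \<in> strip" "\<xi> - of_real r \<in> strip \<longleftrightarrow> \<xi> \<in> strip" for \<xi> r
    by (auto simp: strip_def)
  define h where "h w = strip_to_disc (E (disc_to_strip w + of_real y) - of_real (e y))" for w
  have E_strip: "E (disc_to_strip w + of_real y) - of_real (e y) \<in> strip" if "norm w < 1" for w
    using maps disc_to_strip_in_strip[OF that] by (auto simp: shift)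
  have hol_h: "h holomorphic_on ball 0 1"
    unfolding h_def
  proof (rule holomorphic_on_compose_gen[OF _ strip_to_disc_holomorphic, unfolded o_def])
    show "(\<lambda>w. E (disc_to_strip w + of_real y) - of_real (e y)) holomorphic_on ball 0 1"
    proof (intro holomorphic_intros)
      show "(\<lambda>w. E (disc_to_strip w + of_real y)) holomorphic_on ball 0 1"
        by (rule holomorphic_on_compose_gen[OF _ hol, unfolded o_def])
           (auto intro!: holomorphic_intros disc_to_strip_holomorphic disc_to_strip_in_strip simp: shift)
    qed
  qed (use E_strip in auto)
  have "norm (h (strip_to_disc (of_real (x - y)))) \<le> norm (strip_to_disc (of_real (x - y)))"
  proof (rule Schwarz_Lemma(1)[OF hol_h])
    show "h 0 = 0" by (simp add: h_def real)
    show "norm (h w) < 1" if "norm w < 1" for w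
      unfolding h_def by (intro norm_strip_to_disc E_strip that)
  qed (simp add: norm_strip_to_disc del: of_real_diff)
  moreover have "h (strip_to_disc (of_real (x - y))) = strip_to_disc (of_real (e x - e y))"
    by (simp add: h_def disc_to_strip_strip_to_disc real del: of_real_diff flip: of_real_add) (simp add: real)
  ultimately have "\<bar>tanh ((e x - e y) / 4)\<bar> \<le> \<bar>tanh ((x - y) / 4)\<bar>"
    by (simp only: strip_to_disc_of_real norm_of_real)
  then have "tanh \<bar>(e x - e y) / 4\<bar> \<le> tanh \<bar>(x - y) / 4\<bar>"
    by (simp only: tanh_real_abs)
  then show ?thesis by simp
qed

text \<open>This is the accumulation point that the identity theorem asks for when an equation is
  extended from the real axis to the strip.\<close>

lemma zero_islimpt_range_of_real: "(0::complex) islimpt range of_real"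
proof -
  have "(\<lambda>n. complex_of_real (1 / real (Suc n))) \<longlonglongrightarrow> of_real 0"
    by (intro tendsto_of_real LIMSEQ_Suc lim_1_over_n)
  then show ?thesis
    unfolding islimpt_sequential
    by (intro exI[of _ "\<lambda>n. complex_of_real (1 / real (Suc n))"] conjI allI DiffI rangeI) (simp_all del: of_nat_Suc)
qed

text \<open>The iteration \<open>W \<mapsto> (1 - l) \<xi> + l E W\<close> contracts on the real axis. Montel's theorem turns
  this into a limit on the whole strip, and the identity theorem carries over the equation.\<close>

lemma strip_fixed_point:
  assumes hol: "E holomorphic_on strip" and maps: "E ` strip \<subseteq> strip"
    and real: "\<And>x. E (of_real x) = of_real (e x)"
    and l: "0 \<le> l" "l < 1"
  obtains W w where "W holomorphic_on strip" "W ` strip \<subseteq> strip"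
    "\<And>\<xi>. \<xi> \<in> strip \<Longrightarrow> W \<xi> = of_real (1 - l) * \<xi> + of_real l * E (W \<xi>)"
    "\<And>x. W (of_real x) = of_real (w x)"
proof -
  define F where "F k \<xi> = ((\<lambda>z. of_real (1 - l) * \<xi> + of_real l * E z) ^^ k) \<xi>" for k \<xi>
  have F_0: "F 0 \<xi> = \<xi>" and F_Suc: "F (Suc k) \<xi> = of_real (1 - l) * \<xi> + of_real l * E (F k \<xi>)" for k \<xi>
    by (simp_all add: F_def)
  have F_strip: "F k \<xi> \<in> strip" if "\<xi> \<in> strip" for k \<xi>
    using that maps l by (induction k) (auto simp: F_0 F_Suc simp del: of_real_diff intro!: strip_convex_combination)
  have F_hol: "F k holomorphic_on strip" for k
  proof (induction k)
    case 0
    show ?case using holomorphic_on_ident by (simp add: F_0[abs_def])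
  next
    case (Suc k)
    have "(\<lambda>\<xi>. E (F k \<xi>)) holomorphic_on strip"
      by (rule holomorphic_on_compose_gen[OF Suc hol, unfolded o_def]) (use F_strip in auto)
    then show ?case unfolding F_Suc[abs_def] by (intro holomorphic_intros)
  qed
  have "\<exists>y. (1 - l) * x + l * e y = y \<and> (\<lambda>k. F k (of_real x)) \<longlonglongrightarrow> of_real y" for x
  proof -
    define T where "T y = (1 - l) * x + l * e y" for y
    have T: "\<bar>T a - T b\<bar> \<le> l * \<bar>a - b\<bar>" for a b
      using strip_selfmap_nonexpansive[OF hol maps real, of a b] l
      by (simp add: T_def abs_mult mult_left_mono flip: right_diff_distrib)
    have "\<exists>!y. T y = y"
      by (rule banach_fix_type[OF l]) (use T in \<open>auto simp: dist_real_def\<close>)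
    then obtain y where y: "T y = y" by blast
    have F_T: "F k (of_real x) = of_real ((T ^^ k) x)" for k
      by (induction k) (simp_all add: F_0 F_Suc real T_def)
    have bound: "norm ((T ^^ k) x - y) \<le> l ^ k * \<bar>x - y\<bar>" for k
    proof (induction k)
      case (Suc k)
      have "\<bar>(T ^^ Suc k) x - y\<bar> \<le> l * \<bar>(T ^^ k) x - y\<bar>" using T[of "(T ^^ k) x" y] y by simp
      also have "\<dots> \<le> l * (l ^ k * \<bar>x - y\<bar>)" using Suc l by (intro mult_left_mono) simp_all
      finally show ?case by (simp add: mult.assoc)
    qed simp
    have "(\<lambda>k. l ^ k * \<bar>x - y\<bar>) \<longlonglongrightarrow> 0"
      using l by (intro tendsto_mult_left_zero LIMSEQ_power_zero) simp
    then have "(\<lambda>k. (T ^^ k) x - y) \<longlonglongrightarrow> 0"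
      by (rule Lim_null_comparison[OF always_eventually, OF allI, OF bound])
    then have "(\<lambda>k. (T ^^ k) x) \<longlonglongrightarrow> y" by (simp add: LIM_zero_iff)
    then have "(\<lambda>k. F k (of_real x)) \<longlonglongrightarrow> of_real y" unfolding F_T by (rule tendsto_of_real)
    with y show ?thesis unfolding T_def by blast
  qed
  then obtain w where w: "\<And>x. (1 - l) * x + l * e (w x) = w x"
      "\<And>x. (\<lambda>k. F k (of_real x)) \<longlonglongrightarrow> of_real (w x)"
    by metis

  \<comment> \<open>The strip is unbounded, so Montel's theorem is applied to the iterates
    transported to the disc, where 1 bounds them all.\<close>
  define D where "D k \<xi> = strip_to_disc (F k \<xi>)" for k \<xi>
  have D_hol: "D k holomorphic_on strip" for k
    unfolding D_def
    by (rule holomorphic_on_compose_gen[OF F_hol strip_to_disc_holomorphic, unfolded o_def])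
       (use F_strip in auto)
  have D_norm: "norm (D k \<xi>) < 1" if "\<xi> \<in> strip" for k \<xi>
    unfolding D_def by (intro norm_strip_to_disc F_strip that)
  obtain g r where g: "g holomorphic_on strip" "strict_mono (r :: nat \<Rightarrow> nat)"
      "\<And>\<xi>. \<xi> \<in> strip \<Longrightarrow> (\<lambda>n. D (r n) \<xi>) \<longlonglongrightarrow> g \<xi>"
  proof (rule Montel[OF open_strip, of "range D" D])
    show "\<And>h. h \<in> range D \<Longrightarrow> h holomorphic_on strip" using D_hol by auto
    show "\<exists>B. \<forall>h\<in>range D. \<forall>z\<in>K. norm (h z) \<le> B" if "K \<subseteq> strip" for K
      using D_norm that by (intro exI[of _ 1]) (force intro: less_imp_le)
  qed auto
  have g_real: "g (of_real x) = strip_to_disc (of_real (w x))" for x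
  proof (rule LIMSEQ_unique[OF g(3)])
    have "isCont strip_to_disc (of_real (w x))"
      using holomorphic_on_imp_continuous_on[OF strip_to_disc_holomorphic] open_strip
      by (auto simp: continuous_on_eq_continuous_at)
    then have "(\<lambda>k. D k (of_real x)) \<longlonglongrightarrow> strip_to_disc (of_real (w x))"
      unfolding D_def by (rule isCont_tendsto_compose) (rule w)
    then show "(\<lambda>n. D (r n) (of_real x)) \<longlonglongrightarrow> strip_to_disc (of_real (w x))"
      using LIMSEQ_subseq_LIMSEQ[OF _ g(2)] by (force simp: o_def)
  qed simp
  have g_le: "norm (g \<xi>) \<le> 1" if "\<xi> \<in> strip" for \<xi>
    using D_norm[OF that]
    by (intro LIMSEQ_le_const2[OF tendsto_norm[OF g(3)[OF that]]]) (auto intro: less_imp_le)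
  \<comment> \<open>A limit of maps into the open disc may reach the unit circle. By the maximum
    modulus principle it would then be constant, contradicting its value at 0, which is the image of
    a real fixed point.\<close>
  have g_less: "norm (g \<xi>) < 1" if \<xi>: "\<xi> \<in> strip" for \<xi>
  proof (rule ccontr)
    assume "\<not> norm (g \<xi>) < 1"
    then have \<xi>1: "norm (g \<xi>) = 1" using g_le[OF \<xi>] by simp
    have "g constant_on strip"
      using g_le \<xi>1 \<xi> open_strip convex_connected[OF convex_strip]
      by (intro maximum_modulus_principle[OF g(1), of strip \<xi>]) auto
    then have "g \<xi> = g (of_real 0)" using \<xi> unfolding constant_on_def by (metis of_real_in_strip)
    moreover have "norm (g (of_real 0)) < 1" unfolding g_real by (intro norm_strip_to_disc) simp
    ultimately show False using \<xi>1 by simp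
  qed
  define W where "W \<xi> = disc_to_strip (g \<xi>)" for \<xi>
  have W_strip: "W \<xi> \<in> strip" if "\<xi> \<in> strip" for \<xi>
    unfolding W_def by (intro disc_to_strip_in_strip g_less that)
  have W_hol: "W holomorphic_on strip"
    unfolding W_def
    by (rule holomorphic_on_compose_gen[OF g(1) disc_to_strip_holomorphic, unfolded o_def])
       (use g_less in auto)
  have W_real: "W (of_real x) = of_real (w x)" for x
    by (simp add: W_def g_real disc_to_strip_strip_to_disc)
  have "W \<xi> - (of_real (1 - l) * \<xi> + of_real l * E (W \<xi>)) = 0" if "\<xi> \<in> strip" for \<xi>
  proof (rule analytic_continuation[OF _ open_strip _ _ _ zero_islimpt_range_of_real _ that])
    have "(\<lambda>\<xi>. E (W \<xi>)) holomorphic_on strip"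
      by (rule holomorphic_on_compose_gen[OF W_hol hol, unfolded o_def]) (use W_strip in auto)
    then show "(\<lambda>\<xi>. W \<xi> - (of_real (1 - l) * \<xi> + of_real l * E (W \<xi>))) holomorphic_on strip"
      by (intro holomorphic_intros W_hol)
    show "W z - (of_real (1 - l) * z + of_real l * E (W z)) = 0"
      if z: "z \<in> range of_real" for z
    proof -
      from z obtain x where x: "z = of_real x" by auto
      have "of_real (1 - l) * z + of_real l * E (W z) = of_real ((1 - l) * x + l * e (w x))"
        unfolding x W_real real by simp
      then show ?thesis unfolding w x W_real by simp
    qed
    show "connected strip" by (rule convex_connected[OF convex_strip])
    show "range complex_of_real \<subseteq> strip" by auto
    show "0 \<in> strip" by (simp add: strip_def)
  qed
  with W_hol W_strip W_real show ?thesis by (intro that[of W w]) auto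
qed

section \<open>Right inverses on the slit plane\<close>

text \<open>These are the conditions in \<open>is_subordination\<close> that involve neither a
  measure nor \<open>u\<close>. They are isolated because they already force a function to be an
  \<eta>-transform, see \<open>eta_type_imp_eta\<close>, and because the solutions built for every c
  > 0 satisfy them too.\<close>

definition eta_type :: "(complex \<Rightarrow> complex) \<Rightarrow> bool" where
  "eta_type \<omega> \<longleftrightarrow>
     \<omega> holomorphic_on slit_plane \<and>
     \<omega> ` slit_plane \<subseteq> slit_plane \<and>
     (\<forall>x::real. x < 0 \<longrightarrow> (\<exists>y::real. y < 0 \<and> \<omega> (complex_of_real x) = complex_of_real y)) \<and>
     ((\<lambda>x::real. \<omega> (complex_of_real x)) \<longlongrightarrow> 0) (at_left 0) \<and>
     (\<forall>z. Im z > 0 \<longrightarrow> Arg z \<le> Arg (\<omega> z) \<and> Arg (\<omega> z) < pi)"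

section \<open>The slit plane in the logarithmic coordinate\<close>

lemma exp_strip_not_nonpos:
  assumes "\<xi> \<in> strip" shows "exp \<xi> \<notin> \<real>\<^sub>\<le>\<^sub>0"
proof
  assume *: "exp \<xi> \<in> \<real>\<^sub>\<le>\<^sub>0"
  then have "sin (Im \<xi>) = 0" by (simp add: complex_nonpos_Reals_iff Im_exp)
  with assms have "Im \<xi> = 0" by (simp add: strip_def sin_zero_pi_iff)
  with * show False by (simp add: complex_nonpos_Reals_iff Re_exp)
qed

lemma open_slit_plane: "open slit_plane"
  unfolding slit_plane_def by (intro open_Compl closed_nonneg_Reals_complex)

lemma uminus_in_slit_plane: "- w \<in> slit_plane \<longleftrightarrow> w \<notin> \<real>\<^sub>\<le>\<^sub>0"
  by (auto simp: slit_plane_def complex_nonneg_Reals_iff complex_nonpos_Reals_iff)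

lemma of_real_in_slit_plane [simp]: "complex_of_real x \<in> slit_plane \<longleftrightarrow> x < 0"
  by (auto simp: slit_plane_def complex_nonneg_Reals_iff)

lemma Im_nonzero_in_slit_plane: "Im z \<noteq> 0 \<Longrightarrow> z \<in> slit_plane"
  by (auto simp: slit_plane_def complex_nonneg_Reals_iff)

lemma minus_exp_in_slit_plane: "\<xi> \<in> strip \<Longrightarrow> - exp \<xi> \<in> slit_plane"
  by (simp add: uminus_in_slit_plane exp_strip_not_nonpos)

lemma Ln_minus_in_strip:
  assumes "z \<in> slit_plane" shows "Ln (- z) \<in> strip"
proof -
  have "- z \<notin> \<real>\<^sub>\<le>\<^sub>0" using assms uminus_in_slit_plane[of "- z"] by simp
  moreover from this have "- z \<noteq> 0" by auto
  ultimately show ?thesis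
    using Im_Ln_less_pi[of "- z"] mpi_less_Im_Ln[of "- z"] unfolding strip_def mem_Collect_eq
    by linarith
qed

lemma exp_Ln_minus: "z \<in> slit_plane \<Longrightarrow> exp (Ln (- z)) = - z"
  by (intro exp_Ln) (auto simp: slit_plane_def)

text \<open>The imaginary part of \<open>- exp \<xi>\<close> has the sign of
  \<open>- sin (Im \<xi>)\<close>. The coordinate change thus exchanges halves: the upper half-plane
  corresponds to the lower half of the strip.\<close>

lemma Im_minus_exp_pos_iff:
  assumes "\<xi> \<in> strip" shows "Im (- exp \<xi>) > 0 \<longleftrightarrow> Im \<xi> < 0"
proof -
  have "sin (Im \<xi>) < 0 \<longleftrightarrow> Im \<xi> < 0"
  proof (cases "Im \<xi> < 0")
    case True
    with assms have "sin (- Im \<xi>) > 0" by (intro sin_gt_zero) (auto simp: strip_def)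
    with True show ?thesis by simp
  next
    case False
    with assms have "sin (Im \<xi>) \<ge> 0" by (intro sin_ge_zero) (auto simp: strip_def)
    with False show ?thesis by simp
  qed
  then show ?thesis by (simp add: Im_exp mult_less_0_iff)
qed

lemma Arg_minus_exp:
  assumes "\<xi> \<in> strip" "Im \<xi> < 0" shows "Arg (- exp \<xi>) = Im \<xi> + pi"
proof -
  have "- exp \<xi> = exp (\<xi> + \<i> * of_real pi)" by (simp add: exp_add)
  also have "Arg \<dots> = Im \<xi> + pi"
    using assms by (subst Arg_exp) (auto simp: strip_def)
  finally show ?thesis .
qed

text \<open>In the coordinate \<open>\<xi> = Ln (- z)\<close> the map \<open>z \<mapsto> z exp (- u z)\<close> becomes the self-map
  \<open>E \<xi> = \<xi> - u (- exp \<xi>)\<close> of the strip, and \<open>\<omega> exp (c u \<omega>) = z\<close> becomes the fixed point equation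
  \<open>W = (\<xi> + c E W) / (1 + c)\<close>.\<close>

lemma right_inverse_exists:
  fixes u :: "complex \<Rightarrow> complex" and c :: real
  assumes hol: "u holomorphic_on slit_plane"
    and cnj: "\<And>z. z \<in> slit_plane \<Longrightarrow> u (cnj z) = cnj (u z)"
    and Im_u: "\<And>z. Im z > 0 \<Longrightarrow> Im (u z) \<le> 0"
    and Im_eta: "\<And>z. Im z > 0 \<Longrightarrow> Im (z * exp (- u z)) \<ge> 0"
    and c: "c > 0"
  obtains \<omega> where "eta_type \<omega>" "\<And>z. z \<in> slit_plane \<Longrightarrow> \<omega> z * exp (of_real c * u (\<omega> z)) = z"
proof -
  define E where "E \<xi> = \<xi> - u (- exp \<xi>)" for \<xi>
  define e where "e x = x - Re (u (- of_real (exp x)))" for x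
  define l where "l = c / (1 + c)"
  have l: "0 \<le> l" "l < 1" using c by (auto simp: l_def field_simps)
  have E_hol: "E holomorphic_on strip"
    unfolding E_def
  proof (intro holomorphic_intros)
    show "(\<lambda>\<xi>. u (- exp \<xi>)) holomorphic_on strip"
      by (rule holomorphic_on_compose_gen[OF _ hol, unfolded o_def])
         (auto intro!: holomorphic_intros minus_exp_in_slit_plane)
  qed
  have E_cnj: "E (cnj \<xi>) = cnj (E \<xi>)" if "\<xi> \<in> strip" for \<xi>
    using cnj[OF minus_exp_in_slit_plane[OF that]] by (simp add: E_def exp_cnj)
  have E_real: "E (of_real x) = of_real (e x)" for x
  proof -
    have "cnj (E (of_real x)) = E (of_real x)" using E_cnj[of "of_real x"] by simp
    then have "Im (E (of_real x)) = 0" by (simp add: complex_eq_iff)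
    then show ?thesis by (simp add: E_def e_def complex_eq_iff flip: exp_of_real)
  qed
  have eta_E: "- exp (E \<xi>) = (- exp \<xi>) * exp (- u (- exp \<xi>))" for \<xi>
    by (simp add: E_def exp_diff exp_minus field_simps)
  have Im_E: "Im \<xi> \<le> Im (E \<xi>) \<and> Im (E \<xi>) \<le> 0" if \<xi>: "\<xi> \<in> strip" "Im \<xi> < 0" for \<xi>
  proof
    show "Im \<xi> \<le> Im (E \<xi>)"
      using Im_u[of "- exp \<xi>"] Im_minus_exp_pos_iff[OF \<xi>(1)] \<xi>(2) by (simp add: E_def)
    show "Im (E \<xi>) \<le> 0"
    proof (rule ccontr)
      assume pos: "\<not> Im (E \<xi>) \<le> 0"
      \<comment> \<open>\<open>Im_eta\<close> only controls the sign of a sine, so it sees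
        \<open>Im (E \<xi>)\<close> modulo 2\<pi>. On the vertical segment from \<xi> to the real
        axis, where \<open>E\<close> is real, \<open>Im E\<close> varies continuously from a
        positive value to 0 and meets a value \<open>v\<close> in (0, \<pi>), where the sine has the
        wrong sign.\<close>
      define v where "v = min (Im (E \<xi>)) (pi / 2)"
      have v: "0 < v" "v \<le> Im (E \<xi>)" "v < pi"
        using pos pi_gt_zero by (auto simp: v_def min_def)
      have seg: "Complex (Re \<xi>) s \<in> strip" if "Im \<xi> \<le> s" "s \<le> 0" for s
        using that \<xi> by (auto simp: strip_def)
      have "continuous_on {Im \<xi>..0} (\<lambda>s. Im (E (Complex (Re \<xi>) s)))"
        unfolding Complex_eq
        by (intro continuous_intros continuous_on_compose2[OF holomorphic_on_imp_continuous_on[OF E_hol]])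
           (use seg in \<open>auto simp: Complex_eq\<close>)
      moreover have "Im (E (Complex (Re \<xi>) 0)) = 0"
        using E_real[of "Re \<xi>"] by (simp add: complex_of_real_def)
      ultimately obtain s where s: "Im \<xi> \<le> s" "s \<le> 0" "Im (E (Complex (Re \<xi>) s)) = v"
        using IVT2'[of "\<lambda>s. Im (E (Complex (Re \<xi>) s))" 0 v "Im \<xi>"] v \<xi> by auto
      define \<zeta> where "\<zeta> = Complex (Re \<xi>) s"
      have "s \<noteq> 0" using s(3) v(1) \<open>Im (E (Complex (Re \<xi>) 0)) = 0\<close> by auto
      then have \<zeta>: "\<zeta> \<in> strip" "Im \<zeta> < 0" using s seg by (auto simp: \<zeta>_def)
      have "Im (- exp (E \<zeta>)) \<ge> 0"
        unfolding eta_E using \<zeta> Im_minus_exp_pos_iff by (intro Im_eta) auto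
      moreover have "sin (Im (E \<zeta>)) > 0" using s(3) v by (intro sin_gt_zero) (auto simp: \<zeta>_def)
      ultimately show False by (simp add: Im_exp mult_le_0_iff not_less flip: not_less)
    qed
  qed
  have Im_E': "Im (E \<xi>) \<le> Im \<xi> \<and> 0 \<le> Im (E \<xi>)" if \<xi>: "\<xi> \<in> strip" "Im \<xi> \<ge> 0" for \<xi>
  proof (cases "Im \<xi> = 0")
    case True
    then have "\<xi> = of_real (Re \<xi>)" by (simp add: complex_eq_iff)
    with E_real[of "Re \<xi>"] show ?thesis using True by (metis Im_complex_of_real order_refl)
  next
    case False
    then show ?thesis using Im_E[of "cnj \<xi>"] E_cnj[of \<xi>] \<xi> by (auto simp: strip_def)
  qed
  have E_maps: "E ` strip \<subseteq> strip"
  proof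
    fix y assume "y \<in> E ` strip"
    then obtain \<xi> where "\<xi> \<in> strip" "y = E \<xi>" by auto
    then show "y \<in> strip" using Im_E[of \<xi>] Im_E'[of \<xi>] by (cases "Im \<xi> < 0") (auto simp: strip_def)
  qed
  obtain W w where W: "W holomorphic_on strip" "W ` strip \<subseteq> strip"
      "\<And>\<xi>. \<xi> \<in> strip \<Longrightarrow> W \<xi> = of_real (1 - l) * \<xi> + of_real l * E (W \<xi>)"
    and W_real: "\<And>x. W (of_real x) = of_real (w x)"
    using strip_fixed_point[OF E_hol E_maps E_real l] by metis
  have Im_W_eq: "Im (W \<xi>) = (1 - l) * Im \<xi> + l * Im (E (W \<xi>))" if "\<xi> \<in> strip" for \<xi>
    using arg_cong[OF W(3)[OF that], of Im] by simp
  \<comment> \<open>Under z = - exp \<xi> these bounds become Arg z \<le> Arg (\<omega> z) < \<pi>.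
    They hold because \<open>Im (W \<xi>)\<close> is a weighted mean of \<open>Im \<xi>\<close> and
    \<open>Im (E (W \<xi>))\<close>, and \<open>E\<close> moves imaginary parts towards 0 without
    changing their sign.\<close>
  have Im_W: "Im (W \<xi>) < 0 \<and> Im \<xi> \<le> Im (W \<xi>)" if \<xi>: "\<xi> \<in> strip" "Im \<xi> < 0" for \<xi>
  proof -
    have W\<xi>: "W \<xi> \<in> strip" using W(2) \<xi> by auto
    have neg: "Im (W \<xi>) < 0"
    proof (rule ccontr)
      assume nn: "\<not> Im (W \<xi>) < 0"
      then have "l * Im (E (W \<xi>)) \<le> l * Im (W \<xi>)" using Im_E'[OF W\<xi>] l by (intro mult_left_mono) auto
      then have "(1 - l) * Im (W \<xi>) \<le> (1 - l) * Im \<xi>" 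
        using Im_W_eq[OF \<xi>(1)] unfolding left_diff_distrib mult_1 by linarith
      then show False using l nn \<xi>(2) by simp
    qed
    then have "l * Im (E (W \<xi>)) \<ge> l * Im (W \<xi>)" using Im_E[OF W\<xi>] l by (intro mult_left_mono) auto
    then have "(1 - l) * Im \<xi> \<le> (1 - l) * Im (W \<xi>)" 
        using Im_W_eq[OF \<xi>(1)] unfolding left_diff_distrib mult_1 by linarith
    with neg l show ?thesis by simp
  qed
  have w_eq: "(1 - l) * x = w x - l * e (w x)" for x
  proof -
    have "of_real (w x) = complex_of_real ((1 - l) * x + l * e (w x))"
      using W(3)[of "of_real x"] by (simp add: W_real E_real)
    then show ?thesis by (simp only: of_real_eq_iff)
  qed
  \<comment> \<open>This becomes \<omega>(0-) = 0, since ln (- x) tends to minus infinity as x tends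
    to 0 from the left. Nonexpansiveness makes y - l e(y) nondecreasing, so w x > M would force (1 -
    l) x \<ge> M - l e(M).\<close>
  have w_lim: "filterlim w at_bot at_bot"
    unfolding filterlim_at_bot
  proof
    fix M
    have "w x \<le> M" if x: "x < (M - l * e M) / (1 - l)" for x
    proof (rule ccontr)
      assume "\<not> w x \<le> M"
      then have "e (w x) - e M \<le> w x - M"
        using strip_selfmap_nonexpansive[OF E_hol E_maps E_real, of "w x" M] by simp
      then have "l * (e (w x) - e M) \<le> l * (w x - M)" using l by (intro mult_left_mono)
      also have "\<dots> \<le> w x - M" using l \<open>\<not> w x \<le> M\<close> by (simp add: mult_left_le_one_le)
      finally have "M - l * e M \<le> (1 - l) * x" unfolding w_eq by (simp add: algebra_simps)
      then show False using x l by (simp add: field_simps)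
    qed
    then show "\<forall>\<^sub>F x in at_bot. w x \<le> M"
      unfolding eventually_at_bot_dense by blast
  qed
  define \<omega> where "\<omega> z = - exp (W (Ln (- z)))" for z
  have W_Ln: "W (Ln (- z)) \<in> strip" if "z \<in> slit_plane" for z
    using W(2) Ln_minus_in_strip[OF that] by auto
  have \<omega>_real: "\<omega> (of_real x) = of_real (- exp (w (ln (- x))))" if "x < 0" for x
  proof -
    have "Ln (- of_real x) = of_real (ln (- x))"
      using that Ln_of_real[of "- x"] by simp
    then show ?thesis by (simp add: \<omega>_def W_real exp_of_real)
  qed
  have "eta_type \<omega>"
    unfolding eta_type_def
  proof (intro conjI allI impI)
    have "(\<lambda>z. W (Ln (- z))) holomorphic_on slit_plane"
      by (rule holomorphic_on_compose_gen[OF _ W(1), unfolded o_def])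
         (auto intro!: holomorphic_intros Ln_minus_in_strip simp: slit_plane_def)
    then show "\<omega> holomorphic_on slit_plane" unfolding \<omega>_def by (intro holomorphic_intros)
    show "\<omega> ` slit_plane \<subseteq> slit_plane"
      by (auto simp: \<omega>_def intro!: minus_exp_in_slit_plane W_Ln)
    show "\<exists>y::real. y < 0 \<and> \<omega> (of_real x) = of_real y" if "x < 0" for x :: real
      using \<omega>_real[OF that] by (intro exI[of _ "- exp (w (ln (- x)))"]) simp
    have "filterlim (\<lambda>x::real. - x) (at_right 0) (at_left 0)"
      by (simp add: filterlim_at_left_to_right filterlim_ident)
    then have "filterlim (\<lambda>x::real. w (ln (- x))) at_bot (at_left 0)"
      by (intro filterlim_compose[OF w_lim] filterlim_compose[OF ln_at_0])
    then have "((\<lambda>x::real. complex_of_real (- exp (w (ln (- x))))) \<longlongrightarrow> of_real (- 0)) (at_left 0)"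
      by (intro tendsto_of_real tendsto_minus filterlim_compose[OF exp_at_bot])
    moreover have "\<forall>\<^sub>F x::real in at_left 0. complex_of_real (- exp (w (ln (- x)))) = \<omega> (of_real x)"
      using \<omega>_real by (auto simp: eventually_at_filter)
    ultimately have "((\<lambda>x::real. \<omega> (of_real x)) \<longlongrightarrow> of_real (- 0)) (at_left 0)"
      by (rule Lim_transform_eventually)
    then show "((\<lambda>x::real. \<omega> (of_real x)) \<longlongrightarrow> 0) (at_left 0)" by simp
    fix z :: complex assume z: "Im z > 0"
    then have zs: "z \<in> slit_plane" by (intro Im_nonzero_in_slit_plane) simp
    define \<xi> where "\<xi> = Ln (- z)"
    have \<xi>: "\<xi> \<in> strip" "z = - exp \<xi>" "\<omega> z = - exp (W \<xi>)"
      using Ln_minus_in_strip[OF zs] exp_Ln_minus[OF zs] by (simp_all add: \<xi>_def \<omega>_def)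
    then have "Im \<xi> < 0" using Im_minus_exp_pos_iff z by blast
    moreover have "W \<xi> \<in> strip" using W(2) \<xi> by auto
    ultimately have "Arg z = Im \<xi> + pi" "Arg (\<omega> z) = Im (W \<xi>) + pi"
      using \<xi> Im_W[of \<xi>] Arg_minus_exp[of \<xi>] Arg_minus_exp[of "W \<xi>"] by (simp_all only: simp_thms)
    then show "Arg z \<le> Arg (\<omega> z)" "Arg (\<omega> z) < pi"
      using Im_W[OF \<xi>(1) \<open>Im \<xi> < 0\<close>] by simp_all
  qed
  moreover have "\<omega> z * exp (of_real c * u (\<omega> z)) = z" if z: "z \<in> slit_plane" for z
  proof -
    define \<xi> where "\<xi> = Ln (- z)"
    have \<xi>: "\<xi> \<in> strip" "z = - exp \<xi>" "\<omega> z = - exp (W \<xi>)"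
      using Ln_minus_in_strip[OF z] exp_Ln_minus[OF z] by (simp_all add: \<xi>_def \<omega>_def)
    \<comment> \<open>Multiplying by 1 + c undoes the normalization in \<open>l\<close>;
      exponentiating then recovers the multiplicative equation for \<omega>.\<close>
    have "of_real (1 + c) * W \<xi> = of_real ((1 + c) * (1 - l)) * \<xi> + of_real ((1 + c) * l) * E (W \<xi>)"
      by (subst W(3)[OF \<xi>(1)]) (simp add: algebra_simps)
    moreover have "(1 + c) * (1 - l) = 1" "(1 + c) * l = c"
      using c by (simp_all add: l_def field_simps)
    ultimately have "of_real (1 + c) * W \<xi> = \<xi> + of_real c * E (W \<xi>)"
      by (simp only: of_real_1 mult_1_left)
    then have "W \<xi> + of_real c * u (\<omega> z) = \<xi>"
      unfolding \<xi>(3) by (simp add: E_def algebra_simps)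
    then have "exp (W \<xi>) * exp (of_real c * u (\<omega> z)) = exp \<xi>"
      by (metis exp_add)
    then show ?thesis using \<xi>(2,3) by (metis mult_minus_left)
  qed
  ultimately show ?thesis using that by blast
qed

section \<open>The transform as a function on the slit plane\<close>

text \<open>With a = 1 / (1 + s) the quotient |1 - z s| / (1 + s) is |a - z (1 - a)|. This is
  continuous and nonvanishing on the compact interval [0, 1], including a = 0, the point s =
  \<infinity>, so its minimum \<open>c\<close> is positive. The bound dominates the kernels
  integrated below.\<close>

lemma slit_plane_kernel_bound:
  assumes "z \<in> slit_plane"
  obtains c where "c > 0" "\<And>s. s \<ge> 0 \<Longrightarrow> c * (1 + s) \<le> norm (1 - z * complex_of_real s)"
proof -
  define h where "h a = norm (complex_of_real a - z * of_real (1 - a))" for a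
  have h_nz: "h a \<noteq> 0" if "a \<in> {0..1}" for a
  proof
    assume "h a = 0"
    then have eq: "of_real a = z * of_real (1 - a)" by (simp add: h_def)
    show False
    proof (cases "a = 1")
      case False
      then have "z = of_real (a / (1 - a))" using eq by (simp add: field_simps)
      then have "z \<in> \<real>\<^sub>\<ge>\<^sub>0" using that by (auto simp: complex_nonneg_Reals_iff)
      then show False using assms by (simp add: slit_plane_def)
    qed (use eq in simp)
  qed
  have "continuous_on {0..1} h" unfolding h_def by (intro continuous_intros)
  then obtain a0 where a0: "a0 \<in> {0..1}" "\<And>a. a \<in> {0..1} \<Longrightarrow> h a0 \<le> h a"
    using continuous_attains_inf[of "{0..1::real}" h] by auto
  show ?thesis
  proof
    show "h a0 > 0" using h_nz[OF a0(1)] by (simp add: h_def)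
    fix s :: real assume s: "s \<ge> 0"
    have "h a0 \<le> h (1 / (1 + s))" using s by (intro a0(2)) auto
    also have "1 - 1 / (1 + s) = s / (1 + s)" using s by (simp add: field_simps)
    then have "h (1 / (1 + s)) = norm ((1 - z * of_real s) / of_real (1 + s))"
      by (simp add: h_def diff_divide_distrib)
    also have "\<dots> = norm (1 - z * of_real s) / (1 + s)"
      using s by (simp add: norm_divide del: of_real_add)
    finally show "h a0 * (1 + s) \<le> norm (1 - z * complex_of_real s)"
      using s by (simp add: field_simps)
  qed
qed

lemma slit_plane_kernel_nonzero:
  assumes "z \<in> slit_plane" "s \<ge> 0" shows "1 - z * complex_of_real s \<noteq> 0"
proof -
  obtain c where "c > 0" "c * (1 + s) \<le> norm (1 - z * complex_of_real s)"
    using slit_plane_kernel_bound[OF assms(1)] assms(2) by metis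
  moreover from this assms(2) have "c * (1 + s) > 0" by simp
  ultimately show ?thesis by force
qed

section \<open>Analytic properties of \<open>psi\<close> and \<open>eta\<close>\<close>

lemma pos_measuresD:
  assumes "\<mu> \<in> pos_measures"
  shows "sets \<mu> = sets borel" "prob_space \<mu>" "AE s in \<mu>. 0 \<le> s" "\<mu> \<noteq> return borel 0"
  using assms by (auto simp: pos_measures_def)

lemma psi_kernel_integrable:
  assumes \<mu>: "\<mu> \<in> pos_measures" and z: "z \<in> slit_plane"
  shows "integrable \<mu> (\<lambda>s. z * complex_of_real s / (1 - z * complex_of_real s))"
proof -
  interpret prob_space \<mu> by (rule pos_measuresD[OF \<mu>])
  note [measurable_cong] = pos_measuresD(1)[OF \<mu>]
  obtain c where c: "c > 0" "\<And>s. s \<ge> 0 \<Longrightarrow> c * (1 + s) \<le> norm (1 - z * complex_of_real s)"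
    using slit_plane_kernel_bound[OF z] by blast
  have "norm (z * complex_of_real s / (1 - z * complex_of_real s)) \<le> norm z / c" if s: "s \<ge> 0" for s
  proof -
    have "norm (z * complex_of_real s / (1 - z * complex_of_real s)) \<le> norm z * (1 + s) / (c * (1 + s))"
      unfolding norm_divide using s c by (intro frac_le) (auto simp: norm_mult intro!: mult_left_mono)
    then show ?thesis using s by simp
  qed
  then have "AE s in \<mu>. norm (z * complex_of_real s / (1 - z * complex_of_real s)) \<le> norm z / c"
    using pos_measuresD(3)[OF \<mu>] by auto
  then show ?thesis by (rule integrable_const_bound) measurable
qed

text \<open>The difference quotient between z and w is the integral of s / ((1 - z s) (1 - w s)),
  and dominated convergence lets w tend to z under the integral.\<close>

lemma psi_holomorphic:
  assumes \<mu>: "\<mu> \<in> pos_measures"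
  shows "psi \<mu> holomorphic_on slit_plane"
  unfolding holomorphic_on_def field_differentiable_def
proof
  interpret prob_space \<mu> by (rule pos_measuresD[OF \<mu>])
  note [measurable_cong] = pos_measuresD(1)[OF \<mu>]
  fix z assume z: "z \<in> slit_plane"
  obtain c where c: "c > 0" "\<And>s. s \<ge> 0 \<Longrightarrow> c * (1 + s) \<le> norm (1 - z * complex_of_real s)"
    using slit_plane_kernel_bound[OF z] by blast
  obtain r where r: "r > 0" "ball z r \<subseteq> slit_plane"
    using z open_slit_plane open_contains_ball by blast
  \<comment> \<open>The radius c / 2 costs at most half of the lower bound: |1 - w s| \<ge> (c / 2)
    (1 + s) for w in \<open>B\<close>. This yields the dominating constant 2 / c^2.\<close>
  define B where "B = ball z (min r (c / 2))"
  have B_slit: "B \<subseteq> slit_plane" using r by (auto simp: B_def)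
  have bound: "norm (complex_of_real s / ((1 - z * of_real s) * (1 - w * of_real s))) \<le> 2 / c\<^sup>2"
    if w: "w \<in> B" and s: "s \<ge> 0" for w s
  proof -
    have "norm ((w - z) * of_real s) \<le> c / 2 * (1 + s)"
      unfolding norm_mult using w s c(1) by (intro mult_mono) (auto simp: B_def dist_norm norm_minus_commute)
    moreover have "norm (1 - z * of_real s) \<le> norm (1 - w * of_real s) + norm ((w - z) * of_real s)"
      using norm_triangle_ineq[of "1 - w * of_real s" "(w - z) * of_real s"] by (simp add: algebra_simps)
    ultimately have w': "c / 2 * (1 + s) \<le> norm (1 - w * of_real s)" using c(2)[OF s] by (simp add: algebra_simps)
    have "norm (complex_of_real s / ((1 - z * of_real s) * (1 - w * of_real s)))
        \<le> (1 + s) * (1 + s) / ((c * (1 + s)) * (c / 2 * (1 + s)))"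
      unfolding norm_divide norm_mult
    proof (rule frac_le)
      show "norm (complex_of_real s) \<le> (1 + s) * (1 + s)" using s by (simp add: algebra_simps)
      show "0 < c * (1 + s) * (c / 2 * (1 + s))" using s c(1) by (intro mult_pos_pos) auto
      show "c * (1 + s) * (c / 2 * (1 + s)) \<le> norm (1 - z * of_real s) * norm (1 - w * of_real s)"
        using s c(1) by (intro mult_mono c(2) w') auto
    qed (use s in simp)
    also have "\<dots> = 2 / c\<^sup>2"
    proof -
      have "p * p / ((c * p) * (c / 2 * p)) = 2 / c\<^sup>2" if "p > 0" for p
        using that c(1) by (simp add: field_simps power2_eq_square)
      from this[of "1 + s"] s show ?thesis by linarith
    qed
    finally show ?thesis .
  qed
  let ?D = "LINT s|\<mu>. complex_of_real s / ((1 - z * of_real s) * (1 - z * of_real s))"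
  have diff: "(psi \<mu> w - psi \<mu> z) / (w - z) = (LINT s|\<mu>. complex_of_real s / ((1 - z * of_real s) * (1 - w * of_real s)))"
    if w: "w \<in> B" "w \<noteq> z" for w
  proof -
    have w': "w \<in> slit_plane" using w B_slit by auto
    have "psi \<mu> w - psi \<mu> z = (LINT s|\<mu>. w * complex_of_real s / (1 - w * complex_of_real s)
        - z * complex_of_real s / (1 - z * complex_of_real s))"
      unfolding psi_def by (intro Bochner_Integration.integral_diff[symmetric] psi_kernel_integrable \<mu> z w')
    also have "\<dots> = (LINT s|\<mu>. (w - z) * (complex_of_real s / ((1 - z * of_real s) * (1 - w * of_real s))))"
    proof (rule integral_cong_AE)
      show "AE s in \<mu>. w * complex_of_real s / (1 - w * complex_of_real s)
          - z * complex_of_real s / (1 - z * complex_of_real s)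
          = (w - z) * (complex_of_real s / ((1 - z * of_real s) * (1 - w * of_real s)))"
        using pos_measuresD(3)[OF \<mu>]
      proof eventually_elim
        case (elim s)
        then show ?case
          using slit_plane_kernel_nonzero[OF z, of s] slit_plane_kernel_nonzero[OF w', of s]
          by (simp add: divide_simps) (simp add: algebra_simps)
      qed
    qed measurable
    also have "\<dots> = (w - z) * (LINT s|\<mu>. complex_of_real s / ((1 - z * of_real s) * (1 - w * of_real s)))"
      by (rule integral_mult_right_zero)
    finally show ?thesis using w by simp
  qed
  have "((\<lambda>w. (psi \<mu> w - psi \<mu> z) / (w - z)) \<longlongrightarrow> ?D) (at z within B)"
    unfolding tendsto_at_iff_sequentially o_def
  proof (intro allI impI)
    fix X :: "nat \<Rightarrow> complex" assume X: "\<forall>i. X i \<in> B - {z}" "X \<longlonglongrightarrow> z"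
    have "(\<lambda>i. LINT s|\<mu>. complex_of_real s / ((1 - z * of_real s) * (1 - X i * of_real s))) \<longlonglongrightarrow> ?D"
    proof (rule integral_dominated_convergence[where w = "\<lambda>_. 2 / c\<^sup>2"])
      show "AE s in \<mu>. (\<lambda>i. complex_of_real s / ((1 - z * of_real s) * (1 - X i * of_real s)))
          \<longlonglongrightarrow> complex_of_real s / ((1 - z * of_real s) * (1 - z * of_real s))"
        using pos_measuresD(3)[OF \<mu>]
      proof eventually_elim
        case (elim s)
        then show ?case using slit_plane_kernel_nonzero[OF z, of s] by (intro tendsto_intros X(2)) auto
      qed
      show "AE s in \<mu>. norm (complex_of_real s / ((1 - z * of_real s) * (1 - X i * of_real s))) \<le> 2 / c\<^sup>2" for i
        using pos_measuresD(3)[OF \<mu>] by eventually_elim (use bound X in auto)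
    qed measurable
    then show "(\<lambda>i. (psi \<mu> (X i) - psi \<mu> z) / (X i - z)) \<longlonglongrightarrow> ?D"
      using diff X(1) by simp
  qed
  then have "(psi \<mu> has_field_derivative ?D) (at z within B)"
    by (simp add: has_field_derivative_iff)
  then have "(psi \<mu> has_field_derivative ?D) (at z)"
    using r(1) c(1) by (subst (asm) at_within_open) (auto simp: B_def)
  then show "\<exists>D. (psi \<mu> has_field_derivative D) (at z within slit_plane)"
    using has_field_derivative_at_within by blast
qed

lemma Im_psi_nonneg:
  assumes \<mu>: "\<mu> \<in> pos_measures" and z: "Im z > 0"
  shows "Im (psi \<mu> z) \<ge> 0"
proof -
  have "z \<in> slit_plane" using z by (intro Im_nonzero_in_slit_plane) simp
  then have "Im (psi \<mu> z) = (LINT s|\<mu>. Im (z * complex_of_real s / (1 - z * complex_of_real s)))"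
    unfolding psi_def by (intro integral_Im[symmetric] psi_kernel_integrable \<mu>)
  also have "\<dots> \<ge> 0"
  proof (rule integral_nonneg_AE)
    show "AE s in \<mu>. 0 \<le> Im (z * complex_of_real s / (1 - z * complex_of_real s))"
      using pos_measuresD(3)[OF \<mu>]
    proof eventually_elim
      case (elim s)
      have "Im (z * complex_of_real s / (1 - z * complex_of_real s))
          = Im z * s / (cmod (1 - z * complex_of_real s))\<^sup>2"
        unfolding Im_divide cmod_power2 by (simp add: algebra_simps)
      then show ?case using elim z by simp
    qed
  qed
  finally show ?thesis .
qed

text \<open>The map p \<mapsto> p / (1 + p) divides imaginary parts by |1 + p|^2. The result
  supplies the hypothesis \<open>Im_eta\<close> of \<open>right_inverse_exists\<close>.\<close>

lemma Im_eta_nonneg: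
  assumes "\<mu> \<in> pos_measures" "Im z > 0"
  shows "Im (eta \<mu> z) \<ge> 0"
proof -
  have "Im (eta \<mu> z) = Im (psi \<mu> z) / (cmod (1 + psi \<mu> z))\<^sup>2"
    unfolding eta_def Im_divide cmod_power2 by (simp add: algebra_simps)
  then show ?thesis using Im_psi_nonneg[OF assms] by simp
qed

text \<open>Because 1 + z s / (1 - z s) = 1 / (1 - z s), the function 1 + \<psi> is a Stieltjes-type
  integral. It is the form in which a measure is matched with a given \<omega>, through 1 + \<psi> =
  1 / (1 - \<omega>).\<close>

lemma one_plus_psi_of_real:
  assumes \<mu>: "\<mu> \<in> pos_measures" and x: "x < 0"
  shows "1 + psi \<mu> (of_real x) = of_real (LINT s|\<mu>. 1 / (1 - x * s))"
proof -
  interpret prob_space \<mu> by (rule pos_measuresD[OF \<mu>])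
  note [measurable_cong] = pos_measuresD(1)[OF \<mu>]
  have z: "complex_of_real x \<in> slit_plane" using x by simp
  have "1 + psi \<mu> (of_real x)
      = (LINT s|\<mu>. 1 + of_real x * complex_of_real s / (1 - of_real x * complex_of_real s))"
    unfolding psi_def
    by (subst Bochner_Integration.integral_add) (use psi_kernel_integrable[OF \<mu> z] in \<open>auto simp: prob_space\<close>)
  also have "\<dots> = (LINT s|\<mu>. complex_of_real (1 / (1 - x * s)))"
  proof (rule integral_cong_AE)
    show "AE s in \<mu>. 1 + of_real x * complex_of_real s / (1 - of_real x * complex_of_real s)
        = complex_of_real (1 / (1 - x * s))"
      using pos_measuresD(3)[OF \<mu>]
    proof eventually_elim
      case (elim s)
      then show ?case using slit_plane_kernel_nonzero[OF z, of s] by (simp add: field_simps)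
    qed
  qed measurable
  also have "\<dots> = of_real (LINT s|\<mu>. 1 / (1 - x * s))" by (rule integral_complex_of_real)
  finally show ?thesis .
qed

section \<open>Poisson and Herglotz formulas\<close>

lemma Cauchy_integral_unit_circle:
  fixes G :: "complex \<Rightarrow> complex"
  assumes G: "G holomorphic_on cball 0 1" and w: "norm w < 1"
  shows "((\<lambda>t. G (cis t) * (cis t / (cis t - w))) has_integral 2 * pi * G w) {0..2 * pi}"
proof -
  have "((\<lambda>u. G u / (u - w)) has_contour_integral 2 * of_real pi * \<i> * G w) (circlepath 0 1)"
    using G w by (intro Cauchy_integral_circlepath_simple) auto
  then have "((\<lambda>t. G (cis t) / (cis t - w) * \<i> * cis t) has_integral 2 * of_real pi * \<i> * G w) {0..2 * pi}"
    unfolding circlepath_def by (subst (asm) has_contour_integral_part_circlepath_iff) simp_all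
  then have "((\<lambda>t. (G (cis t) / (cis t - w) * \<i> * cis t) * (- \<i>)) has_integral 2 * of_real pi * \<i> * G w * (- \<i>)) {0..2 * pi}"
    by (rule has_integral_mult_left)
  then show ?thesis by (simp add: algebra_simps)
qed

text \<open>On the unit circle the Poisson kernel is the average of \<open>(z + w) / (z - w)\<close> and of its
  reflection \<open>(1 + w z) / (1 - w z)\<close>, whose product with \<open>G\<close> is holomorphic.\<close>

lemma Poisson_integral_real_point:
  fixes G :: "complex \<Rightarrow> complex" and w :: real
  assumes G: "G holomorphic_on cball 0 1" and w: "\<bar>w\<bar> < 1"
  shows "((\<lambda>t. Re (G (cis t)) * ((1 - w\<^sup>2) / (1 + w\<^sup>2 - 2 * w * cos t))) has_integral
           2 * pi * Re (G (of_real w))) {0..2 * pi}"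
proof -
  let ?w = "complex_of_real w"
  define H where "H z = G z * ((1 + ?w * z) / (1 - ?w * z))" for z
  have nz: "1 - ?w * z \<noteq> 0" if "norm z \<le> 1" for z
  proof
    assume "1 - ?w * z = 0"
    then have "norm (?w * z) = 1" by (metis eq_iff_diff_eq_0 norm_one)
    moreover have "norm (?w * z) \<le> \<bar>w\<bar>" using that by (simp add: norm_mult mult_left_le)
    ultimately show False using w by simp
  qed
  have H: "H holomorphic_on cball 0 1"
    unfolding H_def using nz by (intro holomorphic_intros G) auto
  have kernel: "2 * (cis t / (cis t - ?w)) - 1 + (1 + ?w * cis t) / (1 - ?w * cis t)
      = of_real (2 * ((1 - w\<^sup>2) / (1 + w\<^sup>2 - 2 * w * cos t)))" for t
  proof -
    define q where "q = (1 + ?w * cis t) / (1 - ?w * cis t)"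
    have ne: "cis t - ?w \<noteq> 0"
    proof
      assume "cis t - ?w = 0"
      then have "norm (cis t) = norm ?w" by simp
      then show False using w by simp
    qed
    have "2 * (cis t / (cis t - ?w)) - 1 = (cis t + ?w) / (cis t - ?w)"
      using ne by (simp add: field_simps)
    also have "\<dots> = (cis t * (1 + ?w * cnj (cis t))) / (cis t * (1 - ?w * cnj (cis t)))"
      unfolding distrib_left right_diff_distrib mult.left_commute[of "cis t" ?w]
      by (simp add: cis_cnj cis_mult)
    also have "\<dots> = cnj q" by (simp add: q_def)
    finally have "2 * (cis t / (cis t - ?w)) - 1 + q = of_real (2 * Re q)"
      by (simp add: complex_eq_iff)
    also have "Re q = (1 - w\<^sup>2) / (1 + w\<^sup>2 - 2 * w * cos t)"
    proof -
      have "Re q = (1 - w\<^sup>2 * ((cos t)\<^sup>2 + (sin t)\<^sup>2)) / (1 + w\<^sup>2 * ((cos t)\<^sup>2 + (sin t)\<^sup>2) - 2 * w * cos t)"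
        unfolding q_def Re_divide
        by (simp add: power2_eq_square algebra_simps
            del: sin_cos_squared_add sin_cos_squared_add2 sin_cos_squared_add3)
      then show ?thesis by (simp only: sin_cos_squared_add2 mult_1_right)
    qed
    finally show ?thesis by (simp add: q_def)
  qed
  \<comment> \<open>Three Cauchy integrals realize the kernel. Since H 0 = G 0, the last two values
    cancel and 4\<pi> G(w) remains, which is halved because the kernel is twice the Poisson
    kernel.\<close>
  have "((\<lambda>t. 2 * (G (cis t) * (cis t / (cis t - ?w))) - G (cis t) * (cis t / (cis t - 0))
          + H (cis t) * (cis t / (cis t - 0)))
        has_integral 2 * (2 * pi * G ?w) - 2 * pi * G 0 + 2 * pi * H 0) {0..2 * pi}"
    using w by (intro has_integral_add has_integral_diff has_integral_mult_right
        Cauchy_integral_unit_circle[OF G] Cauchy_integral_unit_circle[OF H]) auto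
  moreover have "2 * (G (cis t) * (cis t / (cis t - ?w))) - G (cis t) * (cis t / (cis t - 0))
          + H (cis t) * (cis t / (cis t - 0))
      = G (cis t) * of_real (2 * ((1 - w\<^sup>2) / (1 + w\<^sup>2 - 2 * w * cos t)))" for t
    unfolding kernel[symmetric] by (simp add: H_def algebra_simps)
  ultimately have "((\<lambda>t. G (cis t) * of_real (2 * ((1 - w\<^sup>2) / (1 + w\<^sup>2 - 2 * w * cos t))))
        has_integral 4 * (pi * G ?w)) {0..2 * pi}"
    by (simp add: H_def)
  then have "((\<lambda>t. Re (G (cis t) * of_real (2 * ((1 - w\<^sup>2) / (1 + w\<^sup>2 - 2 * w * cos t)))) / 2)
        has_integral Re (4 * (pi * G ?w)) / 2) {0..2 * pi}"
    by (intro has_integral_divide has_integral_linear[OF _ bounded_linear_Re, unfolded o_def])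
  moreover have "Re (c * of_real (2 * x)) / 2 = Re c * x" "Re (4 * (pi * c)) / 2 = 2 * pi * Re c"
    for c :: complex and x :: real
    by simp_all
  ultimately show ?thesis by (simp only:)
qed

text \<open>This retraction onto [0, 1] extends kernels continuously and boundedly to the whole
  line, as weak convergence requires, and pushes the weak limit onto [0, 1].\<close>

definition unit_clamp :: "real \<Rightarrow> real" where
  "unit_clamp a = max 0 (min 1 a)"

lemma unit_clamp_range: "unit_clamp a \<in> {0..1}"
  by (auto simp: unit_clamp_def)

lemma unit_clamp_id: "a \<in> {0..1} \<Longrightarrow> unit_clamp a = a"
  by (auto simp: unit_clamp_def)

lemma continuous_unit_clamp: "continuous_on UNIV unit_clamp"
  unfolding unit_clamp_def by (intro continuous_intros)

text \<open>\<open>M\<close> is the image of the Herglotz measure of \<open>g\<close> under \<open>\<theta> \<mapsto> a = (1 + cos \<theta>) / 2\<close>.\<close>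

lemma Herglotz_real_points:
  assumes hol: "g holomorphic_on ball 0 1" and pos: "\<And>z. norm z < 1 \<Longrightarrow> Re (g z) > 0"
  obtains M where "prob_space M" "sets M = sets borel" "AE a in M. a \<in> {0..1::real}"
    "\<And>w::real. \<bar>w\<bar> < 1 \<Longrightarrow>
       Re (g (of_real w)) = Re (g 0) * (LINT a|M. (1 - w\<^sup>2) / (1 + w\<^sup>2 - 2 * w * (2 * a - 1)))"
proof -
  define C where "C = Re (g 0)"
  have C: "C > 0" using pos[of 0] by (simp add: C_def)
  \<comment> \<open>Radii below 1 make the dilated function holomorphic on the closed disc, where
    the Poisson formula applies.\<close>
  define r where "r n = real (Suc n) / real (Suc (Suc n))" for n
  have r: "0 < r n" "r n < 1" for n by (auto simp: r_def)
  have r_lim: "r \<longlonglongrightarrow> 1"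
    unfolding r_def by (intro LIMSEQ_Suc LIMSEQ_n_over_Suc_n)
  have G_hol: "(\<lambda>z. g (of_real (r n) * z)) holomorphic_on cball 0 1" for n
  proof (rule holomorphic_on_compose_gen[OF _ hol, unfolded o_def])
    show "(\<lambda>z. complex_of_real (r n) * z) ` cball 0 1 \<subseteq> ball 0 1"
    proof (rule image_subsetI)
      fix z :: complex assume "z \<in> cball 0 1"
      then have "norm (of_real (r n) * z) \<le> r n" using r[of n] by (simp add: norm_mult mult_left_le)
      then show "of_real (r n) * z \<in> ball 0 1" using r[of n] by simp
    qed
  qed (intro holomorphic_intros)
  \<comment> \<open>The Poisson formula at w = 0 shows that the unnormalized mass is 2\<pi>C, which
    explains the divisor.\<close>
  define d where "d n t = indicator {0..2 * pi} t * (Re (g (of_real (r n) * cis t)) / (2 * pi * C))" for n t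
  define N where "N n = density lborel (\<lambda>t. ennreal (d n t))" for n
  \<comment> \<open>At a real point w the Poisson kernel depends on t only through cos t = 2 a - 1,
    so the pushforward along \<open>a\<close> keeps all that is used.\<close>
  define a where "a t = (1 + cos t) / 2" for t :: real
  define M where "M n = distr (N n) borel a" for n
  have a_range: "a t \<in> {0..1}" for t
  proof -
    have "0 \<le> 1 + cos t" using cos_ge_minus_one[of t] by linarith
    then show ?thesis by (simp add: a_def)
  qed
  have cont_g: "continuous_on {0..2 * pi} (\<lambda>t. Re (g (of_real (r n) * cis t)))" for n
    by (intro continuous_intros continuous_on_compose2[OF holomorphic_on_imp_continuous_on[OF G_hol[of n]]]) auto
  have [measurable]: "d n \<in> borel_measurable borel" for n
    using borel_measurable_continuous_on_indicator[OF _ cont_g[of n]] unfolding d_def by simp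
  have [measurable]: "a \<in> borel_measurable borel" unfolding a_def by measurable
  have d_nonneg: "d n t \<ge> 0" for n t
    unfolding d_def using pos[of "of_real (r n) * cis t"] r[of n] C
    by (auto simp: indicator_def norm_mult intro!: divide_nonneg_nonneg less_imp_le)
  have d_int: "has_bochner_integral lborel (\<lambda>t. d n t * k (a t)) (I / (2 * pi * C))"
    if k: "continuous_on {0..1} k"
      and I: "((\<lambda>t. Re (g (of_real (r n) * cis t)) * k (a t)) has_integral I) {0..2 * pi}" for n k I
  proof -
    have "continuous_on {0..2 * pi} (\<lambda>t. k (a t))"
      by (intro continuous_on_compose2[OF k]) (use a_range in \<open>auto simp: a_def intro!: continuous_intros\<close>)
    then have cont: "continuous_on {0..2 * pi} (\<lambda>t. Re (g (of_real (r n) * cis t)) * k (a t))"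
      by (intro continuous_intros cont_g)
    note integrable = borel_integrable_atLeastAtMost'[OF cont]
    have "has_bochner_integral lborel (\<lambda>t. indicator {0..2 * pi} t *\<^sub>R (Re (g (of_real (r n) * cis t)) * k (a t))) I"
      using integrable set_borel_integral_eq_integral(2)[OF integrable] integral_unique[OF I]
      by (simp add: has_bochner_integral_iff set_integrable_def set_lebesgue_integral_def)
    then have "has_bochner_integral lborel (\<lambda>t. indicator {0..2 * pi} t *\<^sub>R (Re (g (of_real (r n) * cis t)) * k (a t)) / (2 * pi * C)) (I / (2 * pi * C))"
      by (rule has_bochner_integral_divide)
    then show ?thesis by (simp add: d_def mult_ac)
  qed
  have poisson: "((\<lambda>t. Re (g (of_real (r n) * cis t)) * ((1 - w\<^sup>2) / (1 + w\<^sup>2 - 2 * w * (2 * a t - 1)))) has_integral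
      2 * pi * Re (g (of_real (r n * w)))) {0..2 * pi}" if "\<bar>w\<bar> < 1" for n w
  proof -
    have "2 * a t - 1 = cos t" for t by (simp add: a_def field_simps)
    with Poisson_integral_real_point[OF G_hol that, of n] show ?thesis by simp
  qed
  have prob_N: "prob_space (N n)" for n
  proof
    have "((\<lambda>t. Re (g (of_real (r n) * cis t)) * 1) has_integral 2 * pi * C) {0..2 * pi}"
      using poisson[of 0 n] by (simp add: C_def)
    from d_int[OF _ this] have "has_bochner_integral lborel (d n) 1" using C by simp
    then have "(\<integral>\<^sup>+ t. ennreal (d n t) \<partial>lborel) = 1"
      using d_nonneg by (subst nn_integral_eq_integral) (auto simp: has_bochner_integral_iff)
    then show "emeasure (N n) (space (N n)) = 1" by (simp add: N_def emeasure_density)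
  qed
  have prob_M: "prob_space (M n)" for n
    unfolding M_def by (rule prob_space.prob_space_distr[OF prob_N]) (simp add: N_def)
  have distr_M: "real_distribution (M n)" for n
    by (intro real_distribution.intro prob_M real_distribution_axioms.intro) (simp_all add: M_def)
  \<comment> \<open>All \<open>M n\<close> live on [0, 1]; the interval starts at -1 because it is
    open on the left and has to contain 0.\<close>
  have "tight M"
    unfolding tight_def
  proof (intro conjI allI impI distr_M)
    fix \<epsilon> :: real assume "\<epsilon> > 0"
    have "measure (M n) {-1<..1} = 1" for n
    proof -
      interpret prob_space "N n" by (rule prob_N)
      have "measure (M n) {-1<..1} = measure (N n) (a -` {-1<..1} \<inter> space (N n))"
        unfolding M_def by (rule measure_distr) (simp_all add: N_def)
      also have "a -` {-1<..1} \<inter> space (N n) = space (N n)" using a_range by force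
      finally show ?thesis by (simp add: prob_space)
    qed
    with \<open>\<epsilon> > 0\<close> show "\<exists>b c. b < c \<and> (\<forall>n. measure (M n) {b<..c} > 1 - \<epsilon>)"
      by (intro exI[of _ "-1"] exI[of _ 1]) simp
  qed
  from tight_imp_convergent_subsubsequence[OF this strict_mono_id]
  obtain \<rho> M0 where \<rho>: "strict_mono (\<rho> :: nat \<Rightarrow> nat)" and M0: "real_distribution M0" "weak_conv_m (M \<circ> \<rho>) M0"
    by auto
  interpret M0: real_distribution M0 by (rule M0)
  have [measurable]: "unit_clamp \<in> borel_measurable borel"
    by (intro borel_measurable_continuous_onI continuous_unit_clamp)
  define M1 where "M1 = distr M0 borel unit_clamp"
  show ?thesis
  proof (rule that[of M1])
    show "prob_space M1" unfolding M1_def by (rule M0.prob_space_distr) simp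
    show "sets M1 = sets borel" by (simp add: M1_def)
    show "AE b in M1. b \<in> {0..1}" unfolding M1_def using unit_clamp_range by (subst AE_distr_iff) auto
    fix w :: real assume w: "\<bar>w\<bar> < 1"
    define k where "k b = (1 - w\<^sup>2) / (1 + w\<^sup>2 - 2 * w * (2 * b - 1))" for b
    have "1 + w\<^sup>2 - 2 * w * (2 * b - 1) \<noteq> 0" if "b \<in> {0..1}" for b
    proof -
      have "\<bar>2 * b - 1\<bar> \<le> 1" using that by auto
      then have "\<bar>w\<bar> * \<bar>2 * b - 1\<bar> \<le> \<bar>w\<bar>" by (simp add: mult_left_le)
      then have "w * (2 * b - 1) \<le> \<bar>w\<bar>" by (simp flip: abs_mult)
      moreover have "(1 - \<bar>w\<bar>)\<^sup>2 > 0" using w by simp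
      ultimately show ?thesis by (simp add: power2_eq_square algebra_simps)
    qed
    then have k_cont: "continuous_on {0..1} k" unfolding k_def by (intro continuous_intros) auto
    have "bounded (k ` {0..1})"
      by (intro compact_imp_bounded compact_continuous_image k_cont compact_Icc)
    then obtain B where B: "\<And>b. b \<in> {0..1} \<Longrightarrow> norm (k b) \<le> B"
      unfolding bounded_iff by blast
    have kc_cont: "continuous_on UNIV (\<lambda>b. k (unit_clamp b))"
      by (rule continuous_on_compose2[OF k_cont continuous_unit_clamp]) (use unit_clamp_range in auto)
    then have [measurable]: "(\<lambda>b. k (unit_clamp b)) \<in> borel_measurable borel"
      by (rule borel_measurable_continuous_onI)
    have M_k: "(LINT b|M n. k (unit_clamp b)) = Re (g (of_real (r n * w))) / C" for n
    proof -
      have "(LINT b|M n. k (unit_clamp b)) = (LINT t|N n. k (unit_clamp (a t)))"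
        unfolding M_def by (rule integral_distr) (simp_all add: N_def)
      also have "\<dots> = (LINT t|lborel. d n t * k (unit_clamp (a t)))"
        unfolding N_def using d_nonneg by (subst integral_density) simp_all
      also have "\<dots> = (LINT t|lborel. d n t * k (a t))" using a_range by (simp add: unit_clamp_id)
      also have "\<dots> = 2 * pi * Re (g (of_real (r n * w))) / (2 * pi * C)"
        by (intro has_bochner_integral_integral_eq d_int k_cont) (use poisson[OF w, of n] in \<open>simp add: k_def\<close>)
      finally show ?thesis by simp
    qed
    have "(\<lambda>n. LINT b|(M \<circ> \<rho>) n. k (unit_clamp b)) \<longlonglongrightarrow> (LINT b|M0. k (unit_clamp b))"
    proof (rule weak_conv_imp_integral_bdd_continuous_conv)
      show "isCont (\<lambda>b. k (unit_clamp b)) x" for x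
        using kc_cont by (simp add: continuous_on_eq_continuous_at)
      show "norm (k (unit_clamp b)) \<le> B" for b by (intro B unit_clamp_range)
    qed (use M0 distr_M in \<open>auto simp: o_def\<close>)
    then have "(\<lambda>n. Re (g (of_real (r (\<rho> n) * w))) / C) \<longlonglongrightarrow> (LINT b|M0. k (unit_clamp b))"
      by (simp add: M_k)
    moreover have "(\<lambda>n. Re (g (of_real (r (\<rho> n) * w))) / C) \<longlonglongrightarrow> Re (g (of_real (1 * w))) / C"
    proof (intro tendsto_intros)
      have "isCont g (of_real (1 * w))"
        using holomorphic_on_imp_continuous_on[OF hol] w by (simp add: continuous_on_eq_continuous_at)
      moreover have "(\<lambda>n. complex_of_real (r (\<rho> n) * w)) \<longlonglongrightarrow> of_real (1 * w)"
        using LIMSEQ_subseq_LIMSEQ[OF r_lim \<rho>] by (intro tendsto_intros) (simp add: o_def)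
      ultimately show "(\<lambda>n. g (of_real (r (\<rho> n) * w))) \<longlonglongrightarrow> g (of_real (1 * w))"
        by (rule isCont_tendsto_compose)
    qed (use C in simp)
    ultimately have "(LINT b|M0. k (unit_clamp b)) = Re (g (of_real (1 * w))) / C"
      by (rule LIMSEQ_unique)
    moreover have "(LINT b|M1. k b) = (LINT b|M0. k (unit_clamp b))"
      unfolding M1_def by (rule integral_distr) (simp_all add: k_def)
    ultimately show "Re (g (of_real w)) = Re (g 0) * (LINT b|M1. (1 - w\<^sup>2) / (1 + w\<^sup>2 - 2 * w * (2 * b - 1)))"
      using C by (simp add: C_def k_def)
  qed
qed

section \<open>Functions that are transforms of measures\<close>

lemma slit_plane_eq_image: "slit_plane = (\<lambda>\<xi>. - exp \<xi>) ` strip"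
proof (intro equalityI subsetI)
  fix z assume "z \<in> slit_plane"
  then show "z \<in> (\<lambda>\<xi>. - exp \<xi>) ` strip"
    by (intro image_eqI[of _ _ "Ln (- z)"] Ln_minus_in_strip) (simp_all add: exp_Ln_minus)
qed (auto intro: minus_exp_in_slit_plane)

lemma connected_slit_plane: "connected slit_plane"
  unfolding slit_plane_eq_image
  by (intro connected_continuous_image convex_connected convex_strip continuous_intros)

text \<open>The identity theorem needs an accumulation point inside the domain. The boundary point 0
  is excluded, so -1 is taken.\<close>

lemma slit_plane_identity:
  assumes "f holomorphic_on slit_plane" "g holomorphic_on slit_plane"
    and eq: "\<And>x. x < 0 \<Longrightarrow> f (of_real x) = g (of_real x)"
    and z: "z \<in> slit_plane"
  shows "f z = g z"
proof -
  define X where "X n = - 1 - 1 / real (Suc n)" for n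
  have X: "X n < 0" "X n \<noteq> - 1" for n
  proof -
    have "1 / real (Suc n) > 0" by simp
    then show "X n < 0" "X n \<noteq> - 1" unfolding X_def by linarith+
  qed
  have "(\<lambda>n. complex_of_real (X n)) \<longlonglongrightarrow> of_real (- 1 - 0)"
    unfolding X_def by (intro tendsto_intros LIMSEQ_Suc lim_1_over_n)
  then have lim: "of_real (- 1) islimpt (of_real ` {..<0} :: complex set)"
    unfolding islimpt_sequential using X
    by (intro exI[of _ "\<lambda>n. complex_of_real (X n)"] conjI allI DiffI imageI)
       (simp_all del: of_real_minus of_real_1)
  have "f z - g z = 0"
  proof (rule analytic_continuation[OF _ open_slit_plane connected_slit_plane _ _ lim _ z])
    show "(\<lambda>z. f z - g z) holomorphic_on slit_plane" by (intro holomorphic_intros assms)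
    show "of_real ` {..<0} \<subseteq> slit_plane" by auto
    show "complex_of_real (- 1) \<in> slit_plane" by (simp only: of_real_in_slit_plane)
    show "f w - g w = 0" if "w \<in> of_real ` {..<0}" for w using that eq by auto
  qed
  then show ?thesis by simp
qed

lemma eta_type_Arg:
  assumes "eta_type \<omega>" "Im z > 0"
  shows "Arg z \<le> Arg (\<omega> z)" "Arg (\<omega> z) < pi"
  using assms by (simp_all add: eta_type_def)

text \<open>Schwarz reflection: \<omega> and its conjugate reflection are both holomorphic and agree
  on the negative axis, where \<omega> is real.\<close>

lemma eta_type_cnj:
  assumes \<omega>: "eta_type \<omega>" and z: "z \<in> slit_plane"
  shows "\<omega> (cnj z) = cnj (\<omega> z)"
proof -
  have cnj_slit: "cnj ` slit_plane = slit_plane"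
    by (auto simp: slit_plane_def complex_nonneg_Reals_iff image_iff intro!: bexI[of _ "cnj _"])
  have "(cnj \<circ> \<omega> \<circ> cnj) holomorphic_on slit_plane"
    using \<omega> open_slit_plane by (intro holomorphic_on_compose_cnj_cnj) (simp_all add: cnj_slit eta_type_def)
  then have "(cnj \<circ> \<omega> \<circ> cnj) z = \<omega> z"
  proof (rule slit_plane_identity)
    show "(cnj \<circ> \<omega> \<circ> cnj) (of_real x) = \<omega> (of_real x)" if "x < 0" for x
      using that \<omega> by (force simp: eta_type_def)
  qed (use \<omega> z in \<open>auto simp: eta_type_def\<close>)
  then show ?thesis by (metis comp_apply complex_cnj_cnj)
qed

section \<open>Positivity on the right half-plane\<close>

lemma minus_square_in_slit_plane:
  assumes "Re p > 0" shows "- p\<^sup>2 \<in> slit_plane"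
proof -
  have "p\<^sup>2 \<notin> \<real>\<^sub>\<le>\<^sub>0"
    using assms by (auto simp: complex_nonpos_Reals_iff power2_eq_square mult_le_0_iff)
  then show ?thesis by (simp add: uminus_in_slit_plane)
qed

text \<open>The substitution z = - p^2 opens the slit plane to the right half-plane. There the
  bounds on \<open>Arg (\<omega> z)\<close> keep p and \<omega>(z) at least a right angle apart, so
  p times the conjugate of 1 - \<omega>(z) has positive real part. This positivity is the input for
  the Herglotz representation.\<close>

lemma eta_type_half_plane_pos:
  assumes \<omega>: "eta_type \<omega>" and p: "Re p > 0"
  shows "Re (p / (1 - \<omega> (- p\<^sup>2))) > 0"
proof -
  have slit: "- q\<^sup>2 \<in> slit_plane" if "Re q > 0" for q by (rule minus_square_in_slit_plane[OF that])
  have lower: "Re (q / (1 - \<omega> (- q\<^sup>2))) > 0" if q: "Re q > 0" "Im q < 0" for q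
  proof -
    define \<theta> where "\<theta> = Im (Ln q)"
    have "q \<noteq> 0" using q by auto
    have \<theta>: "- (pi / 2) < \<theta>" "\<theta> < 0"
      using q Re_Ln_pos_lt_imp[of q] Im_Ln_pos_lt_imp Im_Ln_pos_le[OF \<open>q \<noteq> 0\<close>] \<open>q \<noteq> 0\<close>
      by (auto simp: \<theta>_def abs_less_iff)
    have q_polar: "q = of_real (norm q) * cis \<theta>"
      using \<open>q \<noteq> 0\<close> by (simp add: \<theta>_def Arg_eq_Im_Ln[symmetric] cis_Arg sgn_eq)
    have "- q\<^sup>2 = - exp (2 * Ln q)"
      using \<open>q \<noteq> 0\<close> by (simp add: exp_double)
    then have Arg_z: "Arg (- q\<^sup>2) = 2 * \<theta> + pi"
      using Arg_minus_exp[of "2 * Ln q"] \<theta> by (simp add: strip_def \<theta>_def)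
    have Im_z: "Im (- q\<^sup>2) > 0" using mult_neg_pos[OF q(2,1)] by (simp add: power2_eq_square)
    then have B: "2 * \<theta> + pi \<le> Arg (\<omega> (- q\<^sup>2))" "Arg (\<omega> (- q\<^sup>2)) < pi"
      using eta_type_Arg[OF \<omega> Im_z] Arg_z by simp_all
    define y B where "y = \<omega> (- q\<^sup>2)" and "B = Arg y"
    have "y \<in> slit_plane" using \<omega> slit[OF q(1)] by (auto simp: y_def eta_type_def)
    then have "y \<noteq> 0" "1 - y \<noteq> 0" by (auto simp: slit_plane_def)
    then have y_polar: "y = of_real (norm y) * cis B"
      by (simp add: B_def cis_Arg sgn_eq)
    \<comment> \<open>From 2\<theta> + \<pi> \<le> B < \<pi> and - \<pi>/2 < \<theta> < 0 the angle
      B - \<theta> lies strictly between \<pi>/2 and 3\<pi>/2.\<close>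
    have "cos (B - \<theta> - pi) > 0" using B \<theta> by (intro cos_gt_zero_pi) (auto simp: B_def y_def)
    then have "cos (B - \<theta>) < 0" by (simp add: cos_diff)
    then have cos_neg: "cos \<theta> * cos B + sin \<theta> * sin B < 0" by (simp add: cos_diff mult.commute)
    have "Re (q * cnj y) = norm q * norm y * (cos \<theta> * cos B + sin \<theta> * sin B)"
      by (subst q_polar, subst y_polar) (simp add: algebra_simps)
    also have "\<dots> \<le> 0" using cos_neg by (intro mult_nonneg_nonpos) auto
    finally have "Re (q * cnj (1 - y)) > 0" using q(1) by (simp add: algebra_simps)
    moreover have "Re (q / (1 - y)) = Re (q * cnj (1 - y)) / (norm (1 - y))\<^sup>2"
      unfolding Re_divide cmod_power2 by (simp add: algebra_simps)
    ultimately show ?thesis using \<open>1 - y \<noteq> 0\<close> by (simp add: y_def)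
  qed
  consider "Im p < 0" | "Im p = 0" | "Im p > 0" by linarith
  then show ?thesis
  proof cases
    case 1
    then show ?thesis using lower p by simp
  next
    case 2
    then have p_real: "p = of_real (Re p)" by (simp add: complex_eq_iff)
    have "- (Re p)\<^sup>2 < 0" using p by simp
    then obtain y where "y < 0" "\<omega> (of_real (- (Re p)\<^sup>2)) = of_real y"
      using \<omega> unfolding eta_type_def by blast
    then have "p / (1 - \<omega> (- p\<^sup>2)) = of_real (Re p / (1 - y))" by (subst (1 2) p_real) simp
    then show ?thesis using p \<open>y < 0\<close> by simp
  next
    case 3
    have "cnj (p / (1 - \<omega> (- p\<^sup>2))) = cnj p / (1 - \<omega> (- (cnj p)\<^sup>2))"
      using eta_type_cnj[OF \<omega> slit[OF p]] by simp
    moreover have "Re (cnj p / (1 - \<omega> (- (cnj p)\<^sup>2))) > 0" using 3 p by (intro lower) auto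
    ultimately show ?thesis by (metis cnj.sel(1))
  qed
qed

section \<open>From positivity to a representing measure\<close>

lemma affine_min_le:
  fixes a y :: real
  assumes "a \<in> {0..1}" shows "min 1 y \<le> a + y * (1 - a)"
proof -
  have "min 1 y * a \<le> 1 * a" "min 1 y * (1 - a) \<le> y * (1 - a)"
    using assms by (intro mult_right_mono; simp)+
  then show ?thesis by (simp add: algebra_simps)
qed

text \<open>\<open>F y = 1 / (1 - \<omega> (- y))\<close> is a Stieltjes transform in the compactified variable \<open>a = 1 / (1 + s)\<close>.\<close>

lemma eta_type_compact_representation:
  assumes \<omega>: "eta_type \<omega>"
  defines "F \<equiv> \<lambda>y. Re (1 / (1 - \<omega> (of_real (- y))))"
  obtains M where "prob_space M" "sets M = sets borel" "AE a in M. a \<in> {0..1::real}"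
    "\<And>y. y > 0 \<Longrightarrow> F y = F 1 * (LINT a|M. 1 / (a + y * (1 - a)))"
proof -
  \<comment> \<open>The positive function p / (1 - \<omega>(- p^2)) is moved to the disc by p = (1 +
    w) / (1 - w).\<close>
  define g where "g w = (1 + w) / (1 - w) / (1 - \<omega> (- ((1 + w) / (1 - w))\<^sup>2))" for w
  have slit: "- ((1 + w) / (1 - w))\<^sup>2 \<in> slit_plane" if "norm w < 1" for w
    by (intro minus_square_in_slit_plane Re_inverse_cayley_pos that)
  have \<omega>_hol: "\<omega> holomorphic_on slit_plane" and \<omega>_slit: "\<omega> ` slit_plane \<subseteq> slit_plane"
    using \<omega> by (auto simp: eta_type_def)
  have ne: "1 - w \<noteq> 0" if "w \<in> ball 0 1" for w :: complex using that by auto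
  have p_hol: "(\<lambda>w. (1 + w) / (1 - w)) holomorphic_on ball 0 1"
    using ne by (intro holomorphic_intros)
  have "(\<lambda>w. \<omega> (- ((1 + w) / (1 - w))\<^sup>2)) holomorphic_on ball 0 1"
  proof (rule holomorphic_on_compose_gen[OF _ \<omega>_hol, unfolded o_def])
    show "(\<lambda>w. - ((1 + w) / (1 - w))\<^sup>2) holomorphic_on ball 0 1"
      by (intro holomorphic_on_minus holomorphic_on_power p_hol)
  qed (use slit in auto)
  then have "(\<lambda>w. 1 - \<omega> (- ((1 + w) / (1 - w))\<^sup>2)) holomorphic_on ball 0 1"
    by (intro holomorphic_on_diff holomorphic_on_const)
  moreover have "1 - \<omega> (- ((1 + w) / (1 - w))\<^sup>2) \<noteq> 0" if "w \<in> ball 0 1" for w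
  proof -
    have "\<omega> (- ((1 + w) / (1 - w))\<^sup>2) \<in> slit_plane" using \<omega>_slit slit[of w] that by auto
    then show ?thesis by (auto simp: slit_plane_def)
  qed
  ultimately have g_hol: "g holomorphic_on ball 0 1"
    unfolding g_def by (intro holomorphic_on_divide p_hol)
  have g_pos: "Re (g w) > 0" if "norm w < 1" for w
    unfolding g_def by (intro eta_type_half_plane_pos[OF \<omega>] Re_inverse_cayley_pos that)
  obtain M where M: "prob_space M" "sets M = sets borel" "AE a in M. a \<in> {0..1::real}"
    and rep: "\<And>w::real. \<bar>w\<bar> < 1 \<Longrightarrow>
       Re (g (of_real w)) = Re (g 0) * (LINT a|M. (1 - w\<^sup>2) / (1 + w\<^sup>2 - 2 * w * (2 * a - 1)))"
    using Herglotz_real_points[OF g_hol g_pos] by metis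
  have "F y = F 1 * (LINT a|M. 1 / (a + y * (1 - a)))" if y: "y > 0" for y
  proof -
    define p where "p = sqrt y"
    define w where "w = (p - 1) / (p + 1)"
    have p: "p > 0" "p\<^sup>2 = y" using y by (simp_all add: p_def)
    have w: "\<bar>w\<bar> < 1" using p(1) by (simp add: w_def abs_if field_simps)
    have wp: "(1 + w) / (1 - w) = p" using p(1) by (simp add: w_def field_simps)
    have wp': "(1 + complex_of_real w) / (1 - of_real w) = of_real p"
      unfolding wp[symmetric] by simp
    have "Re (of_real p * c) = p * Re c" for c by simp
    from this[of "1 / (1 - \<omega> (- (of_real p)\<^sup>2))"] have "Re (g (of_real w)) = p * F y"
      unfolding g_def wp' F_def p(2)[symmetric] by simp
    moreover have "Re (g 0) = F 1" by (simp add: g_def F_def)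
    \<comment> \<open>With y = p^2 the Poisson kernel turns into the Stieltjes kernel times p, the
      same factor that separates \<open>g\<close> from \<open>F\<close>.\<close>
    moreover have "(1 - w\<^sup>2) / (1 + w\<^sup>2 - 2 * w * (2 * a - 1)) = p * (1 / (a + y * (1 - a)))" for a
    proof -
      define q where "q = p + 1"
      have q: "q > 0" "p = q - 1" and wq: "w = 1 - 2 / q"
        using p(1) by (simp_all add: q_def w_def field_simps)
      have "1 - w\<^sup>2 = 4 * p / q\<^sup>2"
        using q(1) by (simp add: q(2) wq field_simps power2_eq_square)
      moreover have "1 + w\<^sup>2 - 2 * w * (2 * a - 1) = 4 * (a + y * (1 - a)) / q\<^sup>2"
        using q(1) by (simp add: p(2)[symmetric] q(2) wq field_simps power2_eq_square)
      moreover have "4 * p / k / (4 * b / k) = p * (1 / b)" if "k \<noteq> 0" for b k :: real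
        using that by simp
      ultimately show ?thesis using q(1) by (metis power_not_zero less_numeral_extra(3))
    qed
    ultimately have "p * F y = F 1 * (LINT a|M. p * (1 / (a + y * (1 - a))))"
      using rep[OF w] by simp
    also have "\<dots> = F 1 * (p * (LINT a|M. 1 / (a + y * (1 - a))))"
      by (subst integral_mult_right_zero) (rule refl)
    finally have "p * F y = p * (F 1 * (LINT a|M. 1 / (a + y * (1 - a))))" by (simp only: mult_ac)
    then show ?thesis using p(1) by simp
  qed
  with M show ?thesis by (intro that[of M])
qed

text \<open>Letting \<open>y\<close> tend to \<open>0\<close> excludes an atom of \<open>M\<close> at \<open>a = 0\<close>, that is, at \<open>s = \<infinity>\<close>, and
  shows that \<open>(F 1 / a) M\<close> has mass \<open>1\<close>. Its image under \<open>s = (1 - a) / a\<close> is the measure sought.\<close>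

lemma eta_type_imp_eta:
  assumes \<omega>: "eta_type \<omega>"
  obtains \<nu> where "\<nu> \<in> pos_measures" "\<And>z. z \<in> slit_plane \<Longrightarrow> \<omega> z = eta \<nu> z"
proof -
  define F where "F y = Re (1 / (1 - \<omega> (of_real (- y))))" for y
  have F: "0 < F y" "F y < 1" "1 / (1 - \<omega> (of_real (- y))) = of_real (F y)" if "y > 0" for y
  proof -
    have "- y < 0" using that by simp
    then obtain x where x: "x < 0" "\<omega> (of_real (- y)) = of_real x"
      using \<omega> unfolding eta_type_def by blast
    then have "1 / (1 - \<omega> (of_real (- y))) = of_real (1 / (1 - x))" by simp
    with x show "0 < F y" "F y < 1" "1 / (1 - \<omega> (of_real (- y))) = of_real (F y)"
      by (simp_all add: F_def)
  qed
  obtain M where M: "prob_space M" "sets M = sets borel" "AE a in M. a \<in> {0..1::real}"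
    and rep: "\<And>y. y > 0 \<Longrightarrow> F y = F 1 * (LINT a|M. 1 / (a + y * (1 - a)))"
    using eta_type_compact_representation[OF \<omega>] unfolding F_def by metis
  interpret M: prob_space M by (rule M)
  note [measurable_cong] = M(2)
  define K where "K = F 1"
  have K: "0 < K" "K < 1" using F[of 1] by (simp_all add: K_def)
  \<comment> \<open>The denominator is a convex combination of 1 and y, hence bounded away from
    0.\<close>
  have int: "integrable M (\<lambda>a. 1 / (a + y * (1 - a)))" if y: "y > 0" for y
  proof (rule M.integrable_const_bound)
    show "AE a in M. norm (1 / (a + y * (1 - a))) \<le> 1 / min 1 y"
      using M(3)
    proof eventually_elim
      case (elim a)
      have "min 1 y > 0" using y by simp
      with affine_min_le[OF elim, of y] show ?case by (simp add: divide_simps split: if_splits)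
    qed
  qed measurable

  \<comment> \<open>At a = 0 the integrand equals 1 / y, while the whole integral is F y / K < 1 /
    K.\<close>
  have atom: "measure M {0} \<le> y / K" if y: "y > 0" for y
  proof -
    have "measure M {0} / y = (LINT a|M. indicator {0} a / y)" by (simp add: M(2))
    also have "\<dots> \<le> (LINT a|M. 1 / (a + y * (1 - a)))"
    proof (rule integral_mono_AE[OF _ int[OF y]])
      show "integrable M (\<lambda>a. indicator {0} a / y)"
        by (intro integrable_divide integrable_real_indicator) (simp_all add: M(2) M.emeasure_eq_measure)
      show "AE a in M. indicator {0} a / y \<le> 1 / (a + y * (1 - a))"
        using M(3)
      proof eventually_elim
        case (elim a)
        have "a + y * (1 - a) \<ge> 0" using elim y by (intro add_nonneg_nonneg mult_nonneg_nonneg) auto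
        then show ?case by (auto simp: indicator_def)
      qed
    qed
    also have "\<dots> = F y / K" using rep[OF y] K by (simp add: K_def)
    also have "\<dots> \<le> 1 / K" using F(2)[OF y] K by (intro divide_right_mono) auto
    finally show ?thesis using y by (simp add: field_simps)
  qed
  have "measure M {0} * K \<le> 0"
  proof (rule field_le_epsilon)
    show "measure M {0} * K \<le> 0 + e" if "e > 0" for e
      using atom[OF that] K by (simp add: pos_le_divide_eq)
  qed
  then have "measure M {0} = 0" using K measure_nonneg[of M "{0}"] by (simp add: mult_le_0_iff) 
  then have "AE a in M. a \<noteq> 0"
    by (intro AE_I[of _ _ "{0}"]) (auto simp: M(2) M.emeasure_eq_measure)
  with M(3) have M_pos: "AE a in M. 0 < a \<and> a \<le> 1" by eventually_elim auto

  define y where "y n = 1 / real (Suc n)" for n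
  have y: "y n > 0" for n by (simp add: y_def)
  have y_lim: "y \<longlonglongrightarrow> 0" unfolding y_def by (intro LIMSEQ_Suc lim_1_over_n)
  have F_lim: "(\<lambda>n. F (y n)) \<longlonglongrightarrow> 1"
  proof -
    have "filterlim (\<lambda>n. - y n) (at_left 0) sequentially"
      unfolding filterlim_at using y tendsto_minus[OF y_lim] by (auto simp: less_imp_neq[symmetric])
    moreover have "((\<lambda>x::real. \<omega> (of_real x)) \<longlongrightarrow> 0) (at_left 0)" using \<omega> by (simp add: eta_type_def)
    ultimately have "(\<lambda>n. \<omega> (of_real (- y n))) \<longlonglongrightarrow> 0" by (rule filterlim_compose[rotated])
    then have "(\<lambda>n. Re (1 / (1 - \<omega> (of_real (- y n))))) \<longlonglongrightarrow> Re (1 / (1 - 0))"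
      by (intro tendsto_intros) simp_all
    then show ?thesis by (simp add: F_def)
  qed
  \<comment> \<open>As \<open>y n\<close> decreases to 0 the integrands increase to 1 / a. Monotone
    convergence and the limit of \<open>F\<close>, which comes from \<omega>(0-) = 0, give the
    integral.\<close>
  have inv: "integrable M (\<lambda>a. 1 / a)" "(LINT a|M. 1 / a) = 1 / K"
  proof -
    have 1: "AE a in M. mono (\<lambda>n. 1 / (a + y n * (1 - a)))"
      using M_pos
    proof eventually_elim
      case (elim a)
      show ?case
      proof (rule monoI)
        fix m n :: nat assume "m \<le> n"
        then have "y n \<le> y m" by (simp add: y_def frac_le)
        then have "y n * (1 - a) \<le> y m * (1 - a)" using elim by (intro mult_right_mono) auto
        moreover have "y n * (1 - a) \<ge> 0" using elim y[of n] by (intro mult_nonneg_nonneg) auto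
        ultimately show "1 / (a + y m * (1 - a)) \<le> 1 / (a + y n * (1 - a))"
          using elim by (intro divide_left_mono mult_pos_pos) auto
      qed
    qed
    have 2: "AE a in M. 0 \<le> 1 / (a + y n * (1 - a))" for n
      using M_pos
    proof eventually_elim
      case (elim a)
      have "y n * (1 - a) \<ge> 0" using elim y[of n] by (intro mult_nonneg_nonneg) auto
      then show ?case using elim by simp
    qed
    have 3: "AE a in M. (\<lambda>n. 1 / (a + y n * (1 - a))) \<longlonglongrightarrow> 1 / a"
      using M_pos
    proof eventually_elim
      case (elim a)
      have "(\<lambda>n. 1 / (a + y n * (1 - a))) \<longlonglongrightarrow> 1 / (a + 0 * (1 - a))"
        using elim by (intro tendsto_intros y_lim) simp
      then show ?case by simp
    qed
    have "(\<lambda>n. F (y n) / K) \<longlonglongrightarrow> 1 / K" using K by (intro tendsto_intros F_lim) simp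
    moreover have "F (y n) / K = (LINT a|M. 1 / (a + y n * (1 - a)))" for n
      using rep[OF y] K by (simp add: K_def)
    ultimately have 4: "(\<lambda>n. LINT a|M. 1 / (a + y n * (1 - a))) \<longlonglongrightarrow> 1 / K" by simp
    show "integrable M (\<lambda>a. 1 / a)" "(LINT a|M. 1 / a) = 1 / K"
      by (rule integral_monotone_convergence_nonneg[OF int[OF y] 1 2 3 4]; measurable)+
  qed

  define D where "D = density M (\<lambda>a. ennreal (K / a))"
  define \<nu> where "\<nu> = distr D borel (\<lambda>a. (1 - a) / a)"
  have "prob_space D"
  proof
    have "emeasure D (space D) = (\<integral>\<^sup>+ a. ennreal (K * (1 / a)) \<partial>M)"
      unfolding D_def by (simp add: emeasure_density cong: nn_integral_cong_simp)
    also have "\<dots> = ennreal (LINT a|M. K * (1 / a))"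
    proof (rule nn_integral_eq_integral)
      show "integrable M (\<lambda>a. K * (1 / a))" by (intro integrable_mult_right inv)
      show "AE a in M. 0 \<le> K * (1 / a)" using M_pos by eventually_elim (use K in auto)
    qed
    also have "(LINT a|M. K * (1 / a)) = K * (1 / K)"
      unfolding inv(2)[symmetric] by (rule integral_mult_right_zero)
    finally show "emeasure D (space D) = 1" using K by simp
  qed
  then have "prob_space \<nu>"
    unfolding \<nu>_def by (rule prob_space.prob_space_distr) (simp add: D_def)
  \<comment> \<open>For s = (1 - a) / a one has 1 / (1 + y s) = a / (a + y (1 - a)), and the density
    K / a cancels the factor a.\<close>
  have \<nu>_int: "(LINT s|\<nu>. 1 / (1 + y * s)) = F y" if y: "y > 0" for y
  proof -
    have "(LINT s|\<nu>. 1 / (1 + y * s)) = (LINT a|D. 1 / (1 + y * ((1 - a) / a)))"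
      unfolding \<nu>_def by (rule integral_distr) (simp_all add: D_def)
    also have "\<dots> = (LINT a|M. (K / a) *\<^sub>R (1 / (1 + y * ((1 - a) / a))))"
      unfolding D_def
    proof (rule integral_density)
      show "AE a in M. 0 \<le> K / a" using M_pos by eventually_elim (use K in auto)
    qed measurable
    also have "\<dots> = (LINT a|M. K * (1 / (a + y * (1 - a))))"
    proof (rule integral_cong_AE)
      show "AE a in M. (K / a) *\<^sub>R (1 / (1 + y * ((1 - a) / a))) = K * (1 / (a + y * (1 - a)))"
        using M_pos
      proof eventually_elim
        case (elim a)
        have "a * (1 + y * ((1 - a) / a)) = a + y * (1 - a)" using elim by (simp add: distrib_left)
        then show ?case by simp
      qed
    qed measurable
    also have "\<dots> = K * (LINT a|M. 1 / (a + y * (1 - a)))" by (rule integral_mult_right_zero)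
    finally show ?thesis using rep[OF y] by (simp add: K_def)
  qed
  have \<nu>: "\<nu> \<in> pos_measures"
    unfolding pos_measures_def
  proof (intro CollectI conjI)
    show "sets \<nu> = sets borel" by (simp add: \<nu>_def)
    have "AE a in D. 0 \<le> (1 - a) / a"
      unfolding D_def
    proof (subst AE_density)
      show "AE a in M. 0 < ennreal (K / a) \<longrightarrow> 0 \<le> (1 - a) / a" using M_pos by eventually_elim auto
    qed measurable
    then show "AE s in \<nu>. 0 \<le> s" unfolding \<nu>_def by (subst AE_distr_iff) (simp_all add: D_def)
    \<comment> \<open>For the point mass at 0 the integral at y = 1 would be 1, but F 1 < 1.\<close>
    show "\<nu> \<noteq> return borel 0"
    proof
      assume "\<nu> = return borel 0"
      then have "F 1 = (LINT s|return borel 0. 1 / (1 + s))" using \<nu>_int[of 1] by simp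
      also have "\<dots> = 1" by (subst integral_return) auto
      finally show False using K by (simp add: K_def)
    qed
  qed fact
  have \<omega>_hol: "\<omega> holomorphic_on slit_plane" and \<omega>_slit: "\<omega> ` slit_plane \<subseteq> slit_plane"
    using \<omega> by (auto simp: eta_type_def)
  have ne: "1 - \<omega> z \<noteq> 0" if "z \<in> slit_plane" for z
  proof -
    have "\<omega> z \<in> slit_plane" using \<omega>_slit that by auto
    then show ?thesis by (auto simp: slit_plane_def)
  qed
  have psi_eq: "1 + psi \<nu> z = 1 / (1 - \<omega> z)" if "z \<in> slit_plane" for z
  proof (rule slit_plane_identity[where z = z])
    show "(\<lambda>z. 1 + psi \<nu> z) holomorphic_on slit_plane" by (intro holomorphic_intros psi_holomorphic \<nu>)
    show "(\<lambda>z. 1 / (1 - \<omega> z)) holomorphic_on slit_plane" by (intro holomorphic_intros \<omega>_hol ne)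
    show "1 + psi \<nu> (of_real x) = 1 / (1 - \<omega> (of_real x))" if "x < 0" for x
      using one_plus_psi_of_real[OF \<nu> that] \<nu>_int[of "- x"] F(3)[of "- x"] that by simp
  qed fact
  show ?thesis
  proof (rule that[OF \<nu>])
    fix z assume z: "z \<in> slit_plane"
    have "psi \<nu> z = 1 / (1 - \<omega> z) - 1" using psi_eq[OF z] by (simp add: algebra_simps)
    also have "\<dots> = \<omega> z / (1 - \<omega> z)" using ne[OF z] by (simp add: field_simps)
    finally show "\<omega> z = eta \<nu> z" unfolding eta_def psi_eq[OF z] using ne[OF z] by simp
  qed
qed

section \<open>Infinite divisibility\<close>

text \<open>By \<open>inverse\<close>, every negative preimage of x under the \<eta>-transform
  equals x exp (c v(x)), so this is the value chosen by \<open>inv_into\<close>. Preimages exist for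
  x close to 0 by continuity.\<close>

lemma Sigma_transform_eq_exp:
  fixes c :: real and u :: "complex \<Rightarrow> complex" and v :: "real \<Rightarrow> real"
  assumes \<omega>: "eta_type \<omega>"
    and eta: "\<And>z. z \<in> slit_plane \<Longrightarrow> \<omega> z = eta \<nu> z"
    and inverse: "\<And>z. z \<in> slit_plane \<Longrightarrow> \<omega> z * exp (of_real c * u (\<omega> z)) = z"
    and u_real: "\<And>x. x < 0 \<Longrightarrow> u (of_real x) = of_real (v x)"
  shows "\<forall>\<^sub>F x in at_left 0. Sigma_transform \<nu> x = exp (c * v x)"
proof -
  define h where "h x = Re (\<omega> (of_real x))" for x
  have h: "\<omega> (of_real x) = of_real (h x)" "h x < 0" if x: "x < 0" for x
  proof -
    obtain y where "y < 0" "\<omega> (of_real x) = of_real y" using \<omega> x unfolding eta_type_def by blast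
    then show "\<omega> (of_real x) = of_real (h x)" "h x < 0" by (simp_all add: h_def)
  qed
  have "continuous_on slit_plane \<omega>"
    using \<omega> by (auto simp: eta_type_def intro: holomorphic_on_imp_continuous_on)
  then have "continuous_on {..<0::real} (\<lambda>x. \<omega> (of_real x))"
    by (rule continuous_on_compose2) (auto intro: continuous_intros)
  then have h_cont: "continuous_on {..<0} h"
    unfolding h_def by (rule continuous_on_Re)
  have "((\<lambda>x. Re (\<omega> (of_real x))) \<longlongrightarrow> Re 0) (at_left 0)"
    using \<omega> by (intro tendsto_Re) (simp add: eta_type_def)
  then have h_lim: "(h \<longlongrightarrow> 0) (at_left 0)" by (simp add: h_def[abs_def])
  have Sigma: "Sigma_transform \<nu> x = exp (c * v x)" if x: "h (- 1) < x" "x < 0" for x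
  proof -
    have "\<forall>\<^sub>F w in at_left 0. x < h w" using order_tendstoD(1)[OF h_lim x(2)] .
    moreover have "\<forall>\<^sub>F w in at_left 0. w \<in> {- 1<..<0::real}" by (rule eventually_at_leftI) auto
    ultimately have "\<forall>\<^sub>F w in at_left 0. x < h w \<and> w \<in> {- 1<..<0}" by (rule eventually_conj)
    \<comment> \<open>Since h tends to 0 there is b > -1 with h b > x > h (-1), and the intermediate
      value theorem applies between -1 and b.\<close>
    then obtain b where b: "x < h b" "- 1 < b" "b < 0"
      using eventually_happens'[OF trivial_limit_at_left_real] by force
    have "\<exists>w. - 1 \<le> w \<and> w \<le> b \<and> h w = x"
      by (rule IVT') (use b x in \<open>auto intro: continuous_on_subset[OF h_cont]\<close>)
    then obtain w where "w \<le> b" "h w = x" by blast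
    with b(3) have w: "w < 0" "h w = x" by simp_all
    define f where "f = (\<lambda>w. eta \<nu> (complex_of_real w))"
    have "f w = of_real x" using w h(1)[OF w(1)] eta[of "of_real w"] by (simp add: f_def)
    then have range: "complex_of_real x \<in> f ` {..<0}" using w(1) by (metis image_eqI lessThan_iff)
    define w0 where "w0 = inv_into {..<0} f (of_real x)"
    have "w0 < 0" using inv_into_into[OF range] by (simp add: w0_def)
    have "f w0 = of_real x" using f_inv_into_f[OF range] by (simp add: w0_def)
    then have "\<omega> (of_real w0) = of_real x" using \<open>w0 < 0\<close> eta[of "of_real w0"] by (simp add: f_def)
    then have "of_real w0 = complex_of_real x * exp (of_real c * of_real (v x))"
      using inverse[of "of_real w0"] \<open>w0 < 0\<close> u_real[OF x(2)] by simp
    also have "\<dots> = of_real (x * exp (c * v x))" by (simp flip: exp_of_real)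
    finally have "w0 = x * exp (c * v x)" by (simp only: of_real_eq_iff)
    then show ?thesis using x(2) by (simp add: Sigma_transform_def w0_def f_def)
  qed
  have "\<forall>\<^sub>F x in at_left 0. x \<in> {h (- 1)<..<0}"
    using h(2)[of "- 1"] by (intro eventually_at_leftI) auto
  then show ?thesis by eventually_elim (use Sigma in auto)
qed

text \<open>Multiplying \<Sigma>-transforms exp (d v) adds the parameters d. Every intermediate
  convolution power needs a measure realizing it, which is why \<open>semigroup\<close> is assumed
  for all d > 0.\<close>

lemma free_mult_infinitely_divisibleI:
  fixes v :: "real \<Rightarrow> real"
  assumes semigroup: "\<And>d. d > 0 \<Longrightarrow>
      \<exists>\<sigma>\<in>pos_measures. \<forall>\<^sub>F x in at_left 0. Sigma_transform \<sigma> x = exp (d * v x)"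
    and \<nu>: "\<nu> \<in> pos_measures" "\<forall>\<^sub>F x in at_left 0. Sigma_transform \<nu> x = exp (c * v x)"
    and c: "c > 0"
  shows "free_mult_infinitely_divisible \<nu>"
  unfolding free_mult_infinitely_divisible_def
proof (intro allI impI)
  fix n :: nat assume n: "n \<ge> 1"
  define d where "d = c / n"
  have d: "d > 0" "real n * d = c" using c n by (simp_all add: d_def)
  obtain \<tau> where \<tau>: "\<tau> \<in> pos_measures" "\<forall>\<^sub>F x in at_left 0. Sigma_transform \<tau> x = exp (d * v x)"
    using semigroup[OF d(1)] by blast
  have conv: "is_free_mult_conv \<sigma> \<tau> \<rho>"
    if "\<sigma> \<in> pos_measures" "\<forall>\<^sub>F x in at_left 0. Sigma_transform \<sigma> x = exp (real k * d * v x)"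
      "\<rho> \<in> pos_measures" "\<forall>\<^sub>F x in at_left 0. Sigma_transform \<rho> x = exp (real (Suc k) * d * v x)"
    for \<sigma> \<rho> k
  proof -
    have "\<forall>\<^sub>F x in at_left 0. Sigma_transform \<rho> x = Sigma_transform \<sigma> x * Sigma_transform \<tau> x"
      using that(2,4) \<tau>(2) by eventually_elim (simp add: algebra_simps flip: exp_add)
    with that \<tau> show ?thesis by (simp add: is_free_mult_conv_def)
  qed
  have power: "\<exists>\<sigma>\<in>pos_measures. is_free_mult_power \<tau> (Suc k) \<sigma> \<and>
      (\<forall>\<^sub>F x in at_left 0. Sigma_transform \<sigma> x = exp (real (Suc k) * d * v x))" for k
  proof (induction k)
    case 0
    then show ?case using \<tau> is_free_mult_power.one by auto
  next
    case (Suc k)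
    then obtain \<sigma> where \<sigma>: "\<sigma> \<in> pos_measures" "is_free_mult_power \<tau> (Suc k) \<sigma>"
      "\<forall>\<^sub>F x in at_left 0. Sigma_transform \<sigma> x = exp (real (Suc k) * d * v x)" by blast
    obtain \<rho> where \<rho>: "\<rho> \<in> pos_measures"
      "\<forall>\<^sub>F x in at_left 0. Sigma_transform \<rho> x = exp (real (Suc (Suc k)) * d * v x)"
      using semigroup[of "real (Suc (Suc k)) * d"] d(1) by auto
    show ?case using is_free_mult_power.step[OF \<sigma>(2) conv[OF \<sigma>(1,3) \<rho>]] \<rho> by blast
  qed
  \<comment> \<open>The chain has to end in the given \<nu>. The first n - 1 factors come from
    \<open>power\<close>, and \<nu> itself serves as the result of the last convolution; for n = 1
    there is no such convolution.\<close>
  show "\<exists>\<nu>\<^sub>n\<in>pos_measures. is_free_mult_power \<nu>\<^sub>n n \<nu>"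
  proof (cases "n = 1")
    case True
    then show ?thesis using \<nu>(1) is_free_mult_power.one by auto
  next
    case False
    with n have "2 \<le> n" by simp
    then obtain k where "n = 2 + k" using le_Suc_ex by blast
    then have k: "n = Suc (Suc k)" by simp
    obtain \<sigma> where \<sigma>: "\<sigma> \<in> pos_measures" "is_free_mult_power \<tau> (Suc k) \<sigma>"
      "\<forall>\<^sub>F x in at_left 0. Sigma_transform \<sigma> x = exp (real (Suc k) * d * v x)"
      using power by blast
    have "is_free_mult_conv \<sigma> \<tau> \<nu>"
      by (rule conv[OF \<sigma>(1,3) \<nu>(1)]) (use \<nu>(2) d(2) k in simp)
    then show ?thesis using is_free_mult_power.step[OF \<sigma>(2)] \<tau>(1) k by blast
  qed
qed

theorem proposition3p5:
  fixes \<mu> \<mu>t :: "real measure" and t :: real and u \<omega> :: "complex \<Rightarrow> complex"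
  assumes "\<mu> \<in> pos_measures"
    and "t > 1"
    and "is_log_kappa \<mu> u"
    and "is_free_mult_real_power \<mu> t \<mu>t"
    and "is_subordination \<mu> u t \<mu>t \<omega>"
  shows "\<exists>\<nu>\<in>pos_measures. free_mult_infinitely_divisible \<nu> \<and> (\<forall>z\<in>slit_plane. \<omega> z = eta \<nu> z)"
proof -
  have u_hol: "u holomorphic_on slit_plane"
    and kappa: "\<And>z. z \<in> slit_plane \<Longrightarrow> kappa \<mu> z = exp (u z)"
    and u_cnj: "\<And>z. z \<in> slit_plane \<Longrightarrow> u (cnj z) = cnj (u z)"
    and Im_u: "\<And>z. Im z > 0 \<Longrightarrow> Im (u z) \<le> 0"
    using assms(3) by (auto simp: is_log_kappa_def)
  define v where "v x = Re (u (of_real x))" for x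
  have u_real: "u (of_real x) = of_real (v x)" if "x < 0" for x
  proof -
    have "cnj (u (of_real x)) = u (of_real x)" using u_cnj[of "of_real x"] that by simp
    then show ?thesis by (simp add: complex_eq_iff v_def)
  qed
  have Im_eta: "Im (z * exp (- u z)) \<ge> 0" if z: "Im z > 0" for z
  proof -
    have "z / eta \<mu> z = exp (u z)"
      using kappa[of z] Im_nonzero_in_slit_plane[of z] z by (simp add: kappa_def)
    \<comment> \<open>A zero of \<open>eta\<close> would make the quotient 0 by the convention for
      division, whereas an exponential never vanishes.\<close>
    moreover from this have "eta \<mu> z \<noteq> 0" by (metis div_by_0 exp_not_eq_zero)
    ultimately have "z * exp (- u z) = eta \<mu> z" by (simp add: exp_minus field_simps)
    then show ?thesis using Im_eta_nonneg[OF assms(1) z] by simp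
  qed
  have semigroup: "\<exists>\<sigma>\<in>pos_measures. \<forall>\<^sub>F x in at_left 0. Sigma_transform \<sigma> x = exp (d * v x)"
    if d: "d > 0" for d
  proof -
    obtain \<omega>' where \<omega>': "eta_type \<omega>'"
        "\<And>z. z \<in> slit_plane \<Longrightarrow> \<omega>' z * exp (of_real d * u (\<omega>' z)) = z"
      using right_inverse_exists[OF u_hol u_cnj Im_u Im_eta d] by blast
    obtain \<sigma> where "\<sigma> \<in> pos_measures" "\<And>z. z \<in> slit_plane \<Longrightarrow> \<omega>' z = eta \<sigma> z"
      using eta_type_imp_eta[OF \<omega>'(1)] by blast
    then show ?thesis using Sigma_transform_eq_exp[OF \<omega>'(1) _ \<omega>'(2) u_real] by blast
  qed
  have \<omega>: "eta_type \<omega>" "\<And>z. z \<in> slit_plane \<Longrightarrow> \<omega> z * exp (of_real (t - 1) * u (\<omega> z)) = z"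
    using assms(5) by (auto simp: is_subordination_def eta_type_def Phi_def)
  obtain \<nu> where \<nu>: "\<nu> \<in> pos_measures" "\<And>z. z \<in> slit_plane \<Longrightarrow> \<omega> z = eta \<nu> z"
    using eta_type_imp_eta[OF \<omega>(1)] by blast
  have "\<forall>\<^sub>F x in at_left 0. Sigma_transform \<nu> x = exp ((t - 1) * v x)"
    by (rule Sigma_transform_eq_exp[OF \<omega>(1) \<nu>(2) \<omega>(2) u_real])
  then have "free_mult_infinitely_divisible \<nu>"
    using free_mult_infinitely_divisibleI[OF semigroup \<nu>(1)] assms(2) by simp
  with \<nu> show ?thesis by blast
qed

end
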